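(* For every even positive integer $n$, \[ B_n=(-1)^{\frac n2-1}\prod_{p-1\nmid n}|n|_p^{-1}\prod_{\substack{(p,l)\in\Psi^{\rm irr}_1,\ \Delta_{(p,l)}\neq0\\ n\equiv l\ (\mathrm{mod}\ p-1)}}\Big|p\,\Big(\chi_{(p,l)}-\tfrac{n-l}{p-1}\Big)\Big|_p^{-1}\prod_{\substack{(p,l)\in\Psi^{\rm irr}_1,\ \Delta_{(p,l)}=0\\ n\equiv l\ (\mathrm{mod}\ p-1)}}p^{1+h_0(p,n)}\prod_{p-1\mid n}p^{-1}, \] where all products run over primes $p$. Moreover, for $(p,l)\in\Psi^{\rm irr}_1$ with $\Delta_{(p,l)}=0$ and $n\equiv l \pmod{p-1}$, one has $h_0(p,n)=0$ if and only if the tree $T^0_{(p,l)}$ is trivial, and otherwise $h_0(p,n)\ge1$.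
   Context: $B_n$ are the Bernoulli numbers, $\frac{z}{e^z-1}=\sum_{n\ge0}B_n\frac{z^n}{n!}$. $\varphi$ is Euler's totient; $|x|_p=p^{-\mathrm{ord}_p x}$. For $n\ge1$, $\Psi^{\rm irr}_n=\{(p,l): p \text{ odd prime},\ p^n\mid B_l/l,\ 2\le l<\varphi(p^n),\ l\text{ even}\}$ (irregular pairs of order $n$; $p^n\mid B_l/l$ means $\mathrm{ord}_p(B_l/l)\ge n$). A pair $(p,l)\in\Psi^{\rm irr}_n$ is written $(p,s_1,\dots,s_n)$ with $l=\sum_{\nu=1}^n s_\nu\varphi(p^{\nu-1})$, $0\le s_\nu<p$, $s_1$ even, $2\le s_1\le p-3$; the set of such tuples is $\widehat\Psi^{\rm irr}_n$. For $(p,l)\in\Psi^{\rm irr}_n$, $\Delta_{(p,l)}\in\{0,\dots,p-1\}$ is defined by $\Delta_{(p,l)}\equiv p^{-n}\big(\frac{B_{l+\varphi(p^n)}}{l+\varphi(p^n)}-\frac{B_l}{l}\big)\pmod p$. When $(p,l)\in\Psi^{\rm irr}_1$ with $\Delta_{(p,l)}\neq0$, there is (a known fact) a unique sequence $(s_\nu)_{\nu\ge1}$ with $s_1=l$ and $(p,s_1,\dots,s_n)\in\widehat\Psi^{\rm irr}_n$ for all $n$; set $\chi_{(p,l)}=\sum_{\nu\ge0}s_{\nu+2}p^\nu\in\mathbb{Z}_p$. When $(p,l)\in\Psi^{\rm irr}_1$ with $\Delta_{(p,l)}=0$, the rooted $p$-ary tree $T^0_{(p,l)}$ is defined recursively: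 the root $(p,l)$ has height $0$; a node $(p,l')$ of height $r$ (which lies in $\Psi^{\rm irr}_{r+1}$ with $\Delta_{(p,l')}=0$) has no children if $(p,l')\notin\Psi^{\rm irr}_{r+2}$, and otherwise has the $p$ children $(p,l'+j\varphi(p^{r+1}))$, $j=0,\dots,p-1$, of height $r+1$ (it is known these lie in $\Psi^{\rm irr}_{r+2}$ with vanishing $\Delta$); nodes need not be distinct. The tree is trivial if it consists only of the root. For such $(p,l)$ and $n\equiv l\pmod{p-1}$, $h_0(p,n)$ is the maximal height of a node $(p,l')$ of $T^0_{(p,l)}$ such that $l'$ equals the least nonnegative residue of $n$ modulo $\varphi(p^\nu)$ for some $\nu\ge1$. *)

theory Defs
  imports
    "HOL-Algebra.Ring"
    "HOL-Number_Theory.Number_Theory"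
    "HOL-Computational_Algebra.Formal_Power_Series"
begin

subsection \<open>Bernoulli numbers\<close>

definition bernoulli_egf :: "rat fps" where
  "bernoulli_egf = fps_X / (fps_exp 1 - 1)"

definition bernoulli :: "nat \<Rightarrow> rat" where
  "bernoulli n = fact n * fps_nth bernoulli_egf n"

lemma bernoulli_egf_times: "bernoulli_egf * (fps_exp 1 - 1) = fps_X"
proof -
  have nz: "fps_exp (1::rat) - 1 \<noteq> 0"
  proof
    assume "fps_exp (1::rat) - 1 = 0"
    then have "fps_nth (fps_exp (1::rat) - 1) 1 = 0" by simp
    then show False by simp
  qed
  have "subdegree (fps_exp (1::rat) - 1) = 1"
    by (intro subdegreeI) auto
  then have "fps_exp (1::rat) - 1 dvd fps_X"
    using nz by (subst fps_dvd_iff) auto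
  then show ?thesis
    unfolding bernoulli_egf_def by simp
qed

subsection \<open>The \<open>p\<close>-adic valuation on the rationals\<close>

text \<open>\<open>rat_ord p x\<close> is meaningful for \<open>x \<noteq> 0\<close> only; the convention
  \<open>ord\<^sub>p 0 = \<infinity>\<close> is built into the next two definitions.\<close>

definition rat_ord :: "nat \<Rightarrow> rat \<Rightarrow> int" where
  "rat_ord p x = int (multiplicity (int p) (fst (quotient_of x)))
               - int (multiplicity (int p) (snd (quotient_of x)))"

definition rat_abs :: "nat \<Rightarrow> rat \<Rightarrow> rat" where
  "rat_abs p x = (if x = 0 then 0 else of_nat p powi (- rat_ord p x))"

text \<open>\<open>p ^ n\<close> divides \<open>x\<close> in the sense \<open>ord\<^sub>p x \<ge> n\<close>.\<close>

definition pow_dvd_rat :: "nat \<Rightarrow> nat \<Rightarrow> rat \<Rightarrow> bool" where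
  "pow_dvd_rat p n x \<longleftrightarrow> x = 0 \<or> rat_ord p x \<ge> int n"

subsection \<open>The ring of \<open>p\<close>-adic integers\<close>

text \<open>The inverse limit of the rings \<open>\<int>/p\<^sup>k\<int>\<close>: an element is the sequence of its least
  nonnegative residues modulo \<open>p\<^sup>k\<close>, for \<open>k = 0, 1, 2, \<dots>\<close>\<close>

definition Zp :: "nat \<Rightarrow> (nat \<Rightarrow> int) ring" where
  "Zp p = \<lparr>carrier = {x. \<forall>k. 0 \<le> x k \<and> x k < int p ^ k \<and> x (Suc k) mod int p ^ k = x k},
           mult = (\<lambda>x y k. (x k * y k) mod int p ^ k),
           one = (\<lambda>k. 1 mod int p ^ k),
           zero = (\<lambda>k. 0),
           add = (\<lambda>x y k. (x k + y k) mod int p ^ k)\<rparr>"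

definition Zp_of_int :: "nat \<Rightarrow> int \<Rightarrow> nat \<Rightarrow> int" where
  "Zp_of_int p z = (\<lambda>k. z mod int p ^ k)"

text \<open>The sum of the series \<open>\<Sum>\<nu>\<ge>0. a \<nu> * p ^ \<nu>\<close> in \<open>Zp p\<close>: modulo \<open>p\<^sup>k\<close> only the
  terms with \<open>\<nu> < k\<close> contribute.\<close>

definition Zp_series :: "nat \<Rightarrow> (nat \<Rightarrow> nat) \<Rightarrow> nat \<Rightarrow> int" where
  "Zp_series p a = (\<lambda>k. (\<Sum>\<nu><k. int (a \<nu>) * int p ^ \<nu>) mod int p ^ k)"

text \<open>For \<open>x\<close> in \<open>Zp p\<close>, \<open>x\<close> is divisible by \<open>p\<^sup>k\<close> iff \<open>x k = 0\<close>, so that for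
  \<open>x \<noteq> 0\<close> the greatest such \<open>k\<close> is the order of \<open>x\<close>.\<close>

definition Zp_ord :: "(nat \<Rightarrow> int) \<Rightarrow> nat" where
  "Zp_ord x = (GREATEST k. x k = 0)"

definition Zp_abs :: "nat \<Rightarrow> (nat \<Rightarrow> int) \<Rightarrow> rat" where
  "Zp_abs p x = (if x = \<zero>\<^bsub>Zp p\<^esub> then 0 else 1 / of_nat p ^ Zp_ord x)"

lemma mod_pow_Suc: "(a mod int p ^ Suc k) mod int p ^ k = a mod int p ^ k"
  by (simp add: mod_mod_cancel)

lemma Zp_of_int_carrier: "p > 0 \<Longrightarrow> Zp_of_int p z \<in> carrier (Zp p)"
  by (simp add: Zp_of_int_def Zp_def mod_pow_Suc del: power_Suc)

lemma Zp_cring: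
  assumes "p > 0"
  shows "cring (Zp p)"
proof -
  have small: "x k mod int p ^ k = x k" if "x \<in> carrier (Zp p)" for x k
    using that by (auto simp: Zp_def)
  have step: "x (Suc k) mod int p ^ k = x k" if "x \<in> carrier (Zp p)" for x k
    using that by (auto simp: Zp_def)
  have mem: "(\<lambda>k. f k mod int p ^ k) \<in> carrier (Zp p)"
    if "\<And>k. f (Suc k) mod int p ^ k = f k mod int p ^ k" for f
    using that assms by (simp add: Zp_def mod_pow_Suc del: power_Suc)
  show ?thesis
  proof (rule cringI)
    show "abelian_group (Zp p)"
    proof (rule abelian_groupI)
      fix x y assume xy: "x \<in> carrier (Zp p)" "y \<in> carrier (Zp p)"
      have "(\<lambda>k. (x k + y k) mod int p ^ k) \<in> carrier (Zp p)"
        by (rule mem) (metis mod_add_eq step xy small)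
      then show "x \<oplus>\<^bsub>Zp p\<^esub> y \<in> carrier (Zp p)" by (simp add: Zp_def)
    next
      show "\<zero>\<^bsub>Zp p\<^esub> \<in> carrier (Zp p)" using assms by (simp add: Zp_def)
    next
      fix x y z
      show "x \<oplus>\<^bsub>Zp p\<^esub> y \<oplus>\<^bsub>Zp p\<^esub> z = x \<oplus>\<^bsub>Zp p\<^esub> (y \<oplus>\<^bsub>Zp p\<^esub> z)"
        by (simp add: Zp_def mod_simps add.assoc)
    next
      fix x y
      show "x \<oplus>\<^bsub>Zp p\<^esub> y = y \<oplus>\<^bsub>Zp p\<^esub> x" by (simp add: Zp_def add.commute)
    next
      fix x assume "x \<in> carrier (Zp p)"
      then show "\<zero>\<^bsub>Zp p\<^esub> \<oplus>\<^bsub>Zp p\<^esub> x = x" by (simp add: Zp_def)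
    next
      fix x assume x: "x \<in> carrier (Zp p)"
      have "(\<lambda>k. (- x k) mod int p ^ k) \<in> carrier (Zp p)"
        by (rule mem) (metis mod_minus_eq step x small)
      moreover have "(\<lambda>k. (- x k) mod int p ^ k) \<oplus>\<^bsub>Zp p\<^esub> x = \<zero>\<^bsub>Zp p\<^esub>"
        by (simp add: Zp_def mod_simps)
      ultimately show "\<exists>y\<in>carrier (Zp p). y \<oplus>\<^bsub>Zp p\<^esub> x = \<zero>\<^bsub>Zp p\<^esub>" by blast
    qed
  next
    show "comm_monoid (Zp p)"
    proof (rule comm_monoidI)
      fix x y assume xy: "x \<in> carrier (Zp p)" "y \<in> carrier (Zp p)"
      have "(\<lambda>k. (x k * y k) mod int p ^ k) \<in> carrier (Zp p)"
        by (rule mem) (metis mod_mult_eq step xy small)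
      then show "x \<otimes>\<^bsub>Zp p\<^esub> y \<in> carrier (Zp p)" by (simp add: Zp_def)
    next
      have "(\<lambda>k. 1 mod int p ^ k) \<in> carrier (Zp p)" by (rule mem) simp
      then show "\<one>\<^bsub>Zp p\<^esub> \<in> carrier (Zp p)" by (simp add: Zp_def)
    next
      fix x y z
      show "x \<otimes>\<^bsub>Zp p\<^esub> y \<otimes>\<^bsub>Zp p\<^esub> z = x \<otimes>\<^bsub>Zp p\<^esub> (y \<otimes>\<^bsub>Zp p\<^esub> z)"
        by (simp add: Zp_def mod_simps mult.assoc)
    next
      fix x assume "x \<in> carrier (Zp p)"
      then show "\<one>\<^bsub>Zp p\<^esub> \<otimes>\<^bsub>Zp p\<^esub> x = x" by (simp add: Zp_def mod_simps)
    next
      fix x y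
      show "x \<otimes>\<^bsub>Zp p\<^esub> y = y \<otimes>\<^bsub>Zp p\<^esub> x" by (simp add: Zp_def mult.commute)
    qed
  next
    fix x y z
    show "(x \<oplus>\<^bsub>Zp p\<^esub> y) \<otimes>\<^bsub>Zp p\<^esub> z = x \<otimes>\<^bsub>Zp p\<^esub> z \<oplus>\<^bsub>Zp p\<^esub> y \<otimes>\<^bsub>Zp p\<^esub> z"
      by (simp add: Zp_def mod_simps distrib_right)
  qed
qed

lemma Zp_series_carrier:
  assumes "p > 0"
  shows "Zp_series p a \<in> carrier (Zp p)"
proof -
  have "(\<Sum>\<nu><Suc k. int (a \<nu>) * int p ^ \<nu>) mod int p ^ k
      = (\<Sum>\<nu><k. int (a \<nu>) * int p ^ \<nu>) mod int p ^ k" for k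
    by simp
  then show ?thesis
    using assms by (simp add: Zp_series_def Zp_def mod_pow_Suc del: power_Suc sum.lessThan_Suc)
qed

subsection \<open>Irregular pairs of higher order\<close>

definition Psi_irr :: "nat \<Rightarrow> (nat \<times> nat) set" where
  "Psi_irr n = {(p, l). prime p \<and> odd p \<and> pow_dvd_rat p n (bernoulli l / of_nat l)
                       \<and> 2 \<le> l \<and> l < totient (p ^ n) \<and> even l}"

text \<open>A tuple \<open>(p, s\<^sub>1, \<dots>, s\<^sub>n)\<close> is represented by \<open>p\<close> and the list \<open>[s\<^sub>1, \<dots>, s\<^sub>n]\<close>;
  list indices start from 0, so \<open>s\<^sub>\<nu>\<close> is \<open>s ! (\<nu> - 1)\<close>.\<close>

definition Psi_irr_hat :: "nat \<Rightarrow> (nat \<times> nat list) set" where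
  "Psi_irr_hat n = {(p, s). length s = n \<and> (\<forall>\<nu>\<in>{1..n}. s ! (\<nu> - 1) < p)
                       \<and> even (s ! 0) \<and> 2 \<le> s ! 0 \<and> s ! 0 \<le> p - 3
                       \<and> (p, \<Sum>\<nu>=1..n. s ! (\<nu> - 1) * totient (p ^ (\<nu> - 1))) \<in> Psi_irr n}"

text \<open>The order \<open>n\<close> of the pair is an explicit argument, since a pair may belong to
  \<open>Psi_irr n\<close> for several \<open>n\<close>.\<close>

definition irr_Delta :: "nat \<Rightarrow> nat \<Rightarrow> nat \<Rightarrow> nat" where
  "irr_Delta n p l = (THE d. d < p \<and>
     pow_dvd_rat p 1
       (of_nat d - (bernoulli (l + totient (p ^ n)) / of_nat (l + totient (p ^ n))
                      - bernoulli l / of_nat l) / of_nat p ^ n))"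

text \<open>Sequences \<open>(s\<^sub>\<nu>)\<^sub>\<nu>\<^sub>\<ge>\<^sub>1\<close> are indexed from 0 as well: \<open>s\<^sub>\<nu>\<close> is \<open>s (\<nu> - 1)\<close>.
  Hence the coefficient \<open>s\<^sub>\<nu>\<^sub>+\<^sub>2\<close> of \<open>p\<^sup>\<nu>\<close> in \<open>\<chi>\<close> is \<open>s (\<nu> + 1)\<close>.\<close>

definition irr_seq :: "nat \<Rightarrow> nat \<Rightarrow> nat \<Rightarrow> nat" where
  "irr_seq p l = (THE s. s 0 = l \<and> (\<forall>n\<ge>1. (p, map s [0..<n]) \<in> Psi_irr_hat n))"

definition irr_chi :: "nat \<Rightarrow> nat \<Rightarrow> nat \<Rightarrow> int" where
  "irr_chi p l = Zp_series p (\<lambda>\<nu>. irr_seq p l (\<nu> + 1))"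

subsection \<open>The tree attached to a pair with vanishing \<open>\<Delta>\<close>\<close>

text \<open>\<open>irr_tree p l\<close> is the set of nodes of the tree with root \<open>(p, l)\<close>; a node \<open>(p, l')\<close> of
  height \<open>r\<close> is represented as \<open>(r, l')\<close>. The same pair \<open>(p, l')\<close> may label nodes of
  different heights (take \<open>j = 0\<close>), but at a given height \<open>r\<close> the node is determined by its
  label: all labels are below \<open>totient (p ^ (r + 1))\<close>, so that the parent label and \<open>j\<close> can be
  recovered by division with remainder.\<close>

inductive_set irr_tree :: "nat \<Rightarrow> nat \<Rightarrow> (nat \<times> nat) set" for p l :: nat where
  root: "(0, l) \<in> irr_tree p l"
| child: "\<lbrakk>(r, l') \<in> irr_tree p l; (p, l') \<in> Psi_irr (r + 2); j < p\<rbrakk>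
            \<Longrightarrow> (r + 1, l' + j * totient (p ^ (r + 1))) \<in> irr_tree p l"

definition irr_tree_trivial :: "nat \<Rightarrow> nat \<Rightarrow> bool" where
  "irr_tree_trivial p l \<longleftrightarrow> irr_tree p l = {(0, l)}"

text \<open>A node of height \<open>r\<close> is a pair of order \<open>r + 1\<close>, that is, a tuple
  \<open>(p, s\<^sub>1, \<dots>, s\<^sub>r\<^sub>+\<^sub>1)\<close>; it is compared with the residue of \<open>n\<close> modulo \<open>totient (p ^ \<nu>)\<close> for
  the same order \<open>\<nu> = r + 1\<close>. So the nodes counted are those on the path from the root that
  follows the residues of \<open>n\<close>. Without the link between \<open>r\<close> and \<open>\<nu>\<close>, a label repeated further
  up the tree (through \<open>j = 0\<close>) would be counted although \<open>n\<close> has left that branch.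
  The argument \<open>l\<close> is the residue of \<open>n\<close> modulo \<open>p - 1\<close>.\<close>

definition irr_h0 :: "nat \<Rightarrow> nat \<Rightarrow> nat \<Rightarrow> nat" where
  "irr_h0 p l n = Max {r. \<exists>\<nu>\<ge>1. r + 1 = \<nu> \<and> (r, n mod totient (p ^ \<nu>)) \<in> irr_tree p l}"

end

theory Submission
  imports Defs
begin

text \<open>Since \<open>B\<^sub>n \<noteq> 0\<close> has sign \<open>(- 1)\<close> to the power \<open>n / 2 - 1\<close>, the formula amounts to computing
  \<open>ord\<^sub>p B\<^sub>n\<close> for each prime \<open>p\<close>. For \<open>p - 1 dvd n\<close> it is \<open>- 1\<close> by von Staudt and Clausen. Otherwise
  \<open>ord\<^sub>p B\<^sub>n = ord\<^sub>p n + ord\<^sub>p (B\<^sub>n / n)\<close>, and the last term is governed by the function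
  \<open>F(s) = (1 - p\<^sup>m\<^sup>-\<^sup>1) B\<^sub>m / m\<close> with \<open>m = l + s (p - 1)\<close>, which is linear to high \<open>p\<close>-adic precision:
  if \<open>p\<^sup>v\<close> divides \<open>t\<close>, then \<open>F(s + t) - F(s) - t (F(1) - F(0))\<close> is divisible by \<open>p\<^sup>v\<^sup>+\<^sup>2\<close>. This
  follows from Voronoi's congruence, which approximates \<open>F(s)\<close> by a fixed integer combination of powers
  \<open>x\<^sup>m\<^sup>-\<^sup>1\<close> of \<open>p\<close>-adic units. The slope \<open>F(1) - F(0)\<close> is \<open>p \<Delta>\<close> modulo \<open>p\<^sup>2\<close>. If \<open>\<Delta> \<noteq> 0\<close>, then \<open>F\<close> has
  the unique \<open>p\<close>-adic zero \<open>\<chi>\<close> and \<open>ord\<^sub>p F(s) = 1 + ord\<^sub>p (\<chi> - s)\<close>; if \<open>\<Delta> = 0\<close>, then \<open>F(s)\<close> modulo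
  \<open>p\<^sup>r\<^sup>+\<^sup>2\<close> depends only on \<open>s\<close> modulo \<open>p\<^sup>r\<close>, which is what the tree records.\<close>

subsection \<open>The valuation on the rationals\<close>

lemma multiplicity_of_nat_int:
  assumes "prime p" "n > 0"
  shows "multiplicity (int p) (int n) = multiplicity p n"
proof (rule multiplicity_eqI)
  show "int p ^ multiplicity p n dvd int n"
    by (simp flip: of_nat_power add: multiplicity_dvd)
  have "\<not> p ^ Suc (multiplicity p n) dvd n"
    using assms multiplicity_geI[of n p "Suc (multiplicity p n)"] not_prime_unit by force
  then show "\<not> int p ^ Suc (multiplicity p n) dvd int n"
    by (simp flip: of_nat_power of_nat_mult del: power_Suc)
qed

locale rat_adic =
  fixes p :: nat
  assumes prime_p: "prime p"
begin

abbreviation pd :: "nat \<Rightarrow> rat \<Rightarrow> bool" where "pd \<equiv> pow_dvd_rat p"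

lemma prime_int: "prime (int p)"
  using prime_p by simp

lemma p_pos: "p > 0"
  using prime_p prime_gt_0_nat by blast

lemma p_gt_1: "p > 1"
  using prime_p prime_gt_1_nat by blast

text \<open>Cross-multiplication with the reduced fraction and additivity of
  \<open>multiplicity\<close> show that the order can be read off from any representation as a
  quotient of integers.\<close>

lemma rat_ord_fract:
  fixes a b :: int
  assumes "a \<noteq> 0" "b \<noteq> 0"
  shows "rat_ord p (of_int a / of_int b) = int (multiplicity (int p) a) - int (multiplicity (int p) b)"
proof -
  define q where "q = (of_int a / of_int b :: rat)"
  obtain c d where cd: "quotient_of q = (c, d)" by fastforce
  have d: "d > 0" using quotient_of_denom_pos[OF cd] .
  have q: "q = of_int c / of_int d" using quotient_of_div[OF cd] .
  have "q \<noteq> 0" using assms by (simp add: q_def)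
  then have c: "c \<noteq> 0" using q by auto
  have "(of_int (a * d) :: rat) = of_int (c * b)"
    using q assms d unfolding q_def by (simp add: field_simps)
  then have "a * d = c * b" by (simp only: of_int_eq_iff)
  then have "multiplicity (int p) (a * d) = multiplicity (int p) (c * b)" by simp
  then have "multiplicity (int p) a + multiplicity (int p) d
      = multiplicity (int p) c + multiplicity (int p) b"
    using assms c d prime_int by (simp add: prime_elem_multiplicity_mult_distrib)
  then show ?thesis
    unfolding rat_ord_def q_def[symmetric] cd by simp
qed

text \<open>Multiplying by a denominator \<open>b\<close> prime to \<open>p\<close> turns
  divisibility of rationals into divisibility of integers and covers \<open>x = 0\<close> uniformly.
  The closure rules for \<open>pd\<close> are derived from this form.\<close>

lemma pd_iff:
  "pd k x \<longleftrightarrow> (\<exists>a b :: int. \<not> int p dvd b \<and> x * of_int b = of_int (int p ^ k * a))"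
proof (cases "x = 0")
  case True
  then show ?thesis
    using prime_int by (auto simp: pow_dvd_rat_def intro!: exI[of _ 0] exI[of _ 1])
next
  case False
  obtain c d where cd: "quotient_of x = (c, d)" by fastforce
  have d: "d > 0" using quotient_of_denom_pos[OF cd] .
  have x: "x = of_int c / of_int d" using quotient_of_div[OF cd] .
  have c: "c \<noteq> 0" using x False by auto
  show ?thesis
  proof
    assume "pd k x"
    then have le: "k + multiplicity (int p) d \<le> multiplicity (int p) c"
      using False by (simp add: pow_dvd_rat_def rat_ord_def cd)
    \<comment> \<open>The power of \<open>p\<close> in \<open>d\<close> is cancelled against
      \<open>c\<close>; the cofactor \<open>d'\<close> is the denominator sought.\<close>
    obtain d' where d': "d = int p ^ multiplicity (int p) d * d'" "\<not> int p dvd d'"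
      using multiplicity_decompose'[of d "int p"] d prime_int by (metis less_irrefl not_prime_unit)
    obtain c' where c': "c = int p ^ (k + multiplicity (int p) d) * c'"
      using multiplicity_dvd'[OF le] by (auto elim: dvdE)
    have "x * of_int d' * of_int (int p ^ multiplicity (int p) d) = x * of_int d"
      by (subst (2) d'(1)) simp
    also have "\<dots> = of_int c" using x d by simp
    also have "\<dots> = of_int (int p ^ k * c') * of_int (int p ^ multiplicity (int p) d)"
      by (subst c') (simp add: power_add)
    finally have "x * of_int d' = of_int (int p ^ k * c')" using p_pos by simp
    then show "\<exists>a b :: int. \<not> int p dvd b \<and> x * of_int b = of_int (int p ^ k * a)"
      using d'(2) by blast
  next
    assume "\<exists>a b :: int. \<not> int p dvd b \<and> x * of_int b = of_int (int p ^ k * a)"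
    then obtain a b :: int where b: "\<not> int p dvd b" and e: "x * of_int b = of_int (int p ^ k * a)"
      by blast
    have b0: "b \<noteq> 0" using b by auto
    have a0: "a \<noteq> 0" using e False b0 by auto
    have "x = of_int (int p ^ k * a) / of_int b" using e b0 by (simp add: field_simps)
    then have "rat_ord p x = int (multiplicity (int p) (int p ^ k * a)) - int (multiplicity (int p) b)"
      using rat_ord_fract[of "int p ^ k * a" b] a0 b0 p_pos by simp
    also have "multiplicity (int p) b = 0" using b by (rule not_dvd_imp_multiplicity_0)
    also have "multiplicity (int p) (int p ^ k * a) = k + multiplicity (int p) a"
      using prime_int a0 p_pos p_gt_1 by (simp add: prime_elem_multiplicity_mult_distrib multiplicity_same_power)
    finally show "pd k x" by (simp add: pow_dvd_rat_def)
  qed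
qed

lemma pdI: "\<not> int p dvd b \<Longrightarrow> x * of_int b = of_int (int p ^ k * a) \<Longrightarrow> pd k x"
  using pd_iff by blast

lemma pdE:
  assumes "pd k x"
  obtains a b :: int where "\<not> int p dvd b" "b \<noteq> 0" "x * of_int b = of_int (int p ^ k * a)"
  using assms pd_iff by (metis dvd_0_right)

lemma pd_0 [simp]: "pd k 0"
  by (simp add: pow_dvd_rat_def)

lemma pd_of_int: "pd k (of_int z) \<longleftrightarrow> int p ^ k dvd z"
proof
  assume "int p ^ k dvd z"
  then obtain a where "z = int p ^ k * a" by blast
  then show "pd k (of_int z)" using prime_int by (intro pdI[of 1 _ _ a]) auto
next
  assume "pd k (of_int z)"
  then obtain a b :: int where b: "\<not> int p dvd b" and "of_int z * of_int b = (of_int (int p ^ k * a) :: rat)"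
    by (elim pdE)
  then have "z * b = int p ^ k * a" by (metis of_int_eq_iff of_int_mult)
  then have "int p ^ k dvd z * b" by simp
  moreover have "coprime (int p ^ k) b"
    using b prime_int by (simp add: prime_imp_coprime)
  ultimately show "int p ^ k dvd z" by (simp add: coprime_dvd_mult_left_iff)
qed

lemma pd_of_nat: "pd k (of_nat z) \<longleftrightarrow> p ^ k dvd z"
  using pd_of_int[of k "int z"] by (simp flip: of_nat_power)

lemma pd_mult:
  assumes "pd j x" "pd k y"
  shows "pd (j + k) (x * y)"
proof -
  obtain a b :: int where 1: "\<not> int p dvd b" "x * of_int b = of_int (int p ^ j * a)"
    using assms(1) by (elim pdE)
  obtain c d :: int where 2: "\<not> int p dvd d" "y * of_int d = of_int (int p ^ k * c)"
    using assms(2) by (elim pdE)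
  have "x * y * of_int (b * d) = (x * of_int b) * (y * of_int d)" by simp
  also have "\<dots> = of_int (int p ^ (j + k) * (a * c))"
    unfolding 1 2 by (simp add: power_add)
  finally show ?thesis
    using 1(1) 2(1) prime_int by (intro pdI[of "b * d" _ _ "a * c"]) (auto simp: prime_dvd_mult_iff)
qed

lemma pd_add:
  assumes "pd k x" "pd k y"
  shows "pd k (x + y)"
proof -
  obtain a b :: int where 1: "\<not> int p dvd b" "x * of_int b = of_int (int p ^ k * a)"
    using assms(1) by (elim pdE)
  obtain c d :: int where 2: "\<not> int p dvd d" "y * of_int d = of_int (int p ^ k * c)"
    using assms(2) by (elim pdE)
  have "(x + y) * of_int (b * d) = (x * of_int b) * of_int d + (y * of_int d) * of_int b"
    by (simp add: algebra_simps)
  also have "\<dots> = of_int (int p ^ k * (a * d + c * b))"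
    unfolding 1 2 by (simp add: algebra_simps)
  finally show ?thesis
    using 1(1) 2(1) prime_int by (intro pdI[of "b * d" _ _ "a * d + c * b"]) (auto simp: prime_dvd_mult_iff)
qed

lemma pd_minus [simp]: "pd k (- x) \<longleftrightarrow> pd k x"
proof -
  have "pd k (- x)" if "pd k x" for x
    using pd_mult[OF _ that, of 0 "-1"] pd_of_int[of 0 "-1"] by simp
  then show ?thesis by (metis minus_minus)
qed

lemma pd_diff: "pd k x \<Longrightarrow> pd k y \<Longrightarrow> pd k (x - y)"
  using pd_add[of k x "- y"] by simp

lemma pd_mono:
  assumes "pd k x" "j \<le> k"
  shows "pd j x"
  using assms unfolding pow_dvd_rat_def by force

lemma pd_int_mult: "pd k x \<Longrightarrow> pd k (of_int z * x)"
  using pd_mult[of 0 "of_int z" k x] pd_of_int[of 0 z] by simp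

lemma pd_nat_mult: "pd k x \<Longrightarrow> pd k (of_nat z * x)"
  using pd_int_mult[of k x "int z"] by simp

lemma pd_cong: "pd k (x - y) \<Longrightarrow> pd k x \<longleftrightarrow> pd k y"
  using pd_add[of k "x - y" y] pd_diff[of k x "x - y"] by auto

lemma pd_power_cancel: "pd (j + k) (of_nat p ^ j * x) \<longleftrightarrow> pd k x"
proof
  assume "pd (j + k) (of_nat p ^ j * x)"
  then obtain a b :: int where 1: "\<not> int p dvd b"
      "of_nat p ^ j * x * of_int b = of_int (int p ^ (j + k) * a)"
    by (elim pdE)
  then have "of_nat p ^ j * (x * of_int b) = of_nat p ^ j * of_int (int p ^ k * a)"
    by (simp add: power_add mult.assoc)
  then have "x * of_int b = of_int (int p ^ k * a)" using p_pos by simp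
  then show "pd k x" using 1(1) pdI by blast
next
  assume "pd k x"
  moreover have "pd j (of_nat p ^ j)" using pd_of_nat[of j "p ^ j"] by simp
  ultimately show "pd (j + k) (of_nat p ^ j * x)" using pd_mult by blast
qed

lemma pd_obtain_factor:
  assumes "pd k x"
  obtains y where "pd 0 y" "x = of_nat p ^ k * y"
proof -
  have "x = of_nat p ^ k * (x / of_nat p ^ k)" using p_pos by simp
  moreover from this have "pd 0 (x / of_nat p ^ k)"
    using pd_power_cancel[of k 0] assms by (metis add_0_right)
  ultimately show ?thesis using that by blast
qed

lemma pd_unit_mult:
  assumes "\<not> int p dvd u"
  shows "pd k (of_int u * x) \<longleftrightarrow> pd k x"
proof
  assume "pd k (of_int u * x)"
  then obtain a b :: int where "\<not> int p dvd b" "of_int u * x * of_int b = of_int (int p ^ k * a)"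
    by (elim pdE)
  then show "pd k x" using assms prime_int
    by (intro pdI[of "u * b" _ _ a]) (auto simp: prime_dvd_mult_iff mult_ac)
qed (rule pd_int_mult)

text \<open>After clearing both denominators this is Euclid's lemma: \<open>p\<close> stays prime in
  the ring of \<open>p\<close>-integral rationals.\<close>

lemma pd_prime:
  assumes "pd 0 x" "pd 0 y" "pd 1 (x * y)"
  shows "pd 1 x \<or> pd 1 y"
proof -
  obtain a b :: int where 1: "\<not> int p dvd b" "x * of_int b = of_int a"
    using assms(1) by (elim pdE) simp
  obtain c d :: int where 2: "\<not> int p dvd d" "y * of_int d = of_int c"
    using assms(2) by (elim pdE) simp
  have "pd 1 (of_int (b * d) * (x * y))" using assms(3) by (rule pd_int_mult)
  also have "of_int (b * d) * (x * y) = (x * of_int b) * (y * of_int d)" by simp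
  also have "\<dots> = of_int (a * c)" unfolding 1 2 by simp
  finally have "int p dvd a * c" using pd_of_int by (metis power_one_right)
  then have "int p dvd a \<or> int p dvd c" using prime_int by (simp add: prime_dvd_mult_iff)
  then have "pd 1 (of_int b * x) \<or> pd 1 (of_int d * y)"
    using 1 2 pd_of_int[of 1] by (auto simp: mult.commute)
  then show ?thesis using 1 2 pd_unit_mult by blast
qed

text \<open>Dividing by the denominator modulo \<open>p\<close> gives the residue. Together with
  \<open>pd_residue_unique\<close> this justifies the definite description in
  \<open>irr_Delta\<close>.\<close>

lemma pd_residue:
  assumes "pd 0 x"
  obtains d where "d < p" "pd 1 (of_nat d - x)"
proof -
  obtain a b :: int where 1: "\<not> int p dvd b" "x * of_int b = of_int a"
    using assms by (elim pdE) simp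
  have "coprime b (int p)" using 1 prime_int
    using prime_imp_coprime coprime_commute by blast
  then obtain c where c: "[b * c = 1] (mod int p)" using cong_solve_coprime_int by blast
  define d where "d = nat (a * c mod int p)"
  have d: "int d = a * c mod int p" "d < p" using p_pos by (auto simp: d_def nat_less_iff)
  have "[b * int d = b * (a * c)] (mod int p)"
    unfolding d by (simp add: cong_def mod_mult_right_eq)
  also have "b * (a * c) = a * (b * c)" by simp
  also have "[a * (b * c) = a * 1] (mod int p)" using c by (rule cong_scalar_left)
  finally have "int p dvd b * int d - a" by (simp add: cong_iff_dvd_diff)
  then have "pd 1 (of_int (b * int d - a))" by (simp add: pd_of_int del: of_int_diff)
  also have "of_int (b * int d - a) = of_int b * (of_nat d - x)"
    using 1(2) by (simp add: algebra_simps)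
  finally show ?thesis using that d(2) 1(1) pd_unit_mult by blast
qed

lemma pd_residue_unique:
  assumes "d < p" "d' < p" "pd 1 (of_nat d - x)" "pd 1 (of_nat d' - x)"
  shows "d = d'"
proof -
  have "pd 1 ((of_nat d - x) - (of_nat d' - x))" using assms pd_diff by blast
  then have "pd 1 (of_int (int d - int d'))" by simp
  then have "int p dvd int d - int d'" using pd_of_int by (metis power_one_right)
  then show ?thesis using assms(1,2)
    by (metis cong_iff_dvd_diff cong_less_modulus_unique_nat cong_int_iff)
qed

lemma rat_ord_mult:
  assumes "x \<noteq> 0" "y \<noteq> 0"
  shows "rat_ord p (x * y) = rat_ord p x + rat_ord p y"
proof -
  obtain a b where ab: "quotient_of x = (a, b)" by fastforce
  obtain c d where cd: "quotient_of y = (c, d)" by fastforce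
  have x: "x = of_int a / of_int b" "b > 0" and y: "y = of_int c / of_int d" "d > 0"
    using quotient_of_div quotient_of_denom_pos ab cd by blast+
  have nz: "a \<noteq> 0" "c \<noteq> 0" using x y assms by auto
  have "x * y = of_int (a * c) / of_int (b * d)" using x y by simp
  then show ?thesis
    using rat_ord_fract[of "a * c" "b * d"] rat_ord_fract[of a b] rat_ord_fract[of c d] nz x y prime_int
    by (simp add: prime_elem_multiplicity_mult_distrib)
qed

lemma rat_ord_of_nat: "n > 0 \<Longrightarrow> rat_ord p (of_nat n) = int (multiplicity p n)"
  using rat_ord_fract[of "int n" 1] prime_p by (simp add: multiplicity_of_nat_int)

text \<open>The left side has the shape of \<open>Zp_ord\<close>, so that orders in
  \<open>Zp p\<close> and in the rationals can be compared through divisibility by each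
  \<open>p ^ k\<close>. Integrality makes the order a natural number.\<close>

lemma rat_ord_GREATEST:
  assumes "x \<noteq> 0" "pd 0 x"
  shows "int (GREATEST k. pd k x) = rat_ord p x"
proof -
  have "pd k x \<longleftrightarrow> k \<le> nat (rat_ord p x)" for k
    using assms unfolding pow_dvd_rat_def by auto
  then have "(GREATEST k. pd k x) = nat (rat_ord p x)"
    by (intro Greatest_equality) auto
  then show ?thesis using assms by (auto simp: pow_dvd_rat_def)
qed

end

subsection \<open>Signs of Bernoulli numbers and power sums\<close>

definition power_sum :: "nat \<Rightarrow> nat \<Rightarrow> int" where
  "power_sum n N = (\<Sum>a<N. int a ^ n)"

text \<open>This is the expansion of \<open>(z/2) coth (z/2)\<close>: the added term cancels
  \<open>B\<^sub>1 = - 1/2\<close>, the only nonzero Bernoulli number of odd index.\<close>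

definition bernoulli_fps_even :: "rat fps" where
  "bernoulli_fps_even = bernoulli_egf + fps_const (1/2) * fps_X"

lemma bernoulli_egf_0: "fps_nth bernoulli_egf 0 = 1"
proof -
  have "fps_nth (bernoulli_egf * (fps_exp 1 - 1)) 1 = 1"
    by (simp add: bernoulli_egf_times)
  then show ?thesis by (simp add: fps_mult_nth)
qed

text \<open>Differentiate the product of the series with \<open>fps_exp 1 - 1\<close>, multiply by
  \<open>fps_X\<close>, and cancel the nonzero factor. The result is a Riccati equation from which
  the exponential has disappeared.\<close>

lemma bernoulli_egf_deriv:
  "fps_X * fps_deriv bernoulli_egf
    = bernoulli_egf - fps_X * bernoulli_egf - bernoulli_egf * bernoulli_egf"
proof -
  let ?F = bernoulli_egf and ?E = "fps_exp (1::rat) - 1"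
  have "fps_deriv (?F * ?E) = fps_deriv fps_X" by (simp add: bernoulli_egf_times)
  then have d: "?F * (?E + 1) + fps_deriv ?F * ?E = 1" by (simp add: algebra_simps)
  have E: "?E \<noteq> 0" using bernoulli_egf_times by (metis fps_X_neq_zero mult_zero_right)
  have "?E * (fps_X * fps_deriv ?F) = fps_X * (fps_deriv ?F * ?E)" by (simp only: mult_ac)
  also have "fps_deriv ?F * ?E = 1 - ?F * (?E + 1)" using d by (simp add: algebra_simps)
  also have "fps_X * (1 - ?F * (?E + 1)) = ?F * ?E - fps_X * ?F * ?E - (?F * ?E) * ?F"
    unfolding bernoulli_egf_times by (simp add: algebra_simps)
  also have "\<dots> = ?E * (?F - fps_X * ?F - ?F * ?F)" by (simp add: algebra_simps)
  finally show ?thesis using E by (metis mult_left_cancel)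
qed

text \<open>Removing the linear term of \<open>z / (e\<^sup>z - 1)\<close> turns its differential equation into one
  whose coefficient recursion has terms of constant sign.\<close>

lemma bernoulli_fps_even_deriv:
  "fps_X * fps_deriv bernoulli_fps_even
    = bernoulli_fps_even - bernoulli_fps_even * bernoulli_fps_even + fps_const (1/4) * fps_X ^ 2"
proof -
  \<comment> \<open>The constant \<open>1/2\<close> is hidden behind \<open>h\<close> with
    \<open>h + h = 1\<close>, so that ring normalization applies.\<close>
  define h where "h = (fps_const (1/2) :: rat fps)"
  have h: "h + h = 1" by (simp add: h_def fps_const_add[symmetric])
  have hh: "fps_const (1/4) = h * h" by (simp add: h_def)
  have "fps_X * fps_deriv bernoulli_fps_even = fps_X * fps_deriv bernoulli_egf + h * fps_X"
    by (simp add: bernoulli_fps_even_def h_def[symmetric] algebra_simps) (simp add: h_def)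
  also have "\<dots> = bernoulli_egf + h * fps_X - (h + h) * fps_X * bernoulli_egf - bernoulli_egf * bernoulli_egf"
    unfolding bernoulli_egf_deriv h by simp
  also have "\<dots> = bernoulli_fps_even - bernoulli_fps_even * bernoulli_fps_even + h * h * fps_X ^ 2"
    unfolding bernoulli_fps_even_def h_def[symmetric] by (simp add: algebra_simps power2_eq_square)
  finally show ?thesis unfolding hh .
qed

lemma bernoulli_fps_even_0: "fps_nth bernoulli_fps_even 0 = 1"
  by (simp add: bernoulli_fps_even_def bernoulli_egf_0)

text \<open>Coefficient comparison in the Riccati equation. The two extreme terms of the convolution
  each equal the coefficient at \<open>n\<close>; moved to the left they turn the factor
  \<open>n - 1\<close> into \<open>n + 1\<close>.\<close>

lemma bernoulli_fps_even_rec: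
  assumes "n \<ge> 1"
  shows "of_nat (n + 1) * fps_nth bernoulli_fps_even n
    = (if n = 2 then 1 / 4 else 0)
      - (\<Sum>k=1..<n. fps_nth bernoulli_fps_even k * fps_nth bernoulli_fps_even (n - k))"
proof -
  let ?g = "fps_nth bernoulli_fps_even"
  have "fps_nth (fps_X * fps_deriv bernoulli_fps_even) n
      = fps_nth (bernoulli_fps_even - bernoulli_fps_even * bernoulli_fps_even
          + fps_const (1/4) * fps_X ^ 2) n"
    by (simp only: bernoulli_fps_even_deriv)
  then have "of_nat n * ?g n = ?g n - (\<Sum>k=0..n. ?g k * ?g (n - k)) + (if n = 2 then 1 / 4 else 0)"
    using assms by (simp add: fps_mult_nth[of bernoulli_fps_even bernoulli_fps_even] split: if_splits)
  moreover have "(\<Sum>k=0..n. ?g k * ?g (n - k)) = 2 * ?g n + (\<Sum>k=1..<n. ?g k * ?g (n - k))"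
  proof -
    have "{0..n} = insert 0 (insert n {1..<n})" using assms by auto
    then show ?thesis using assms bernoulli_fps_even_0 by simp
  qed
  ultimately show ?thesis by (simp add: algebra_simps)
qed

text \<open>For odd \<open>n\<close> one of \<open>k\<close> and \<open>n - k\<close> is odd, so
  every product in the recursion vanishes by induction, and the inhomogeneous term occurs only at
  \<open>n = 2\<close>.\<close>

lemma bernoulli_fps_even_odd: "odd n \<Longrightarrow> fps_nth bernoulli_fps_even n = 0"
proof (induction n rule: less_induct)
  case (less n)
  have "(\<Sum>k=1..<n. fps_nth bernoulli_fps_even k * fps_nth bernoulli_fps_even (n - k)) = 0"
  proof (rule sum.neutral, rule ballI)
    fix k assume k: "k \<in> {1..<n}"
    show "fps_nth bernoulli_fps_even k * fps_nth bernoulli_fps_even (n - k) = 0"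
      using less.IH[of k] less.IH[of "n - k"] less.prems k by (cases "odd k") auto
  qed
  moreover have "n \<ge> 1" "n \<noteq> 2" using less.prems by (auto elim: oddE)
  ultimately have "of_nat (n + 1) * fps_nth bernoulli_fps_even n = 0"
    using bernoulli_fps_even_rec[of n] by simp
  then show ?case by (metis add_is_0 mult_eq_0_iff of_nat_eq_0_iff one_neq_zero)
qed

text \<open>After normalization of signs every subtracted product in the recursion is nonpositive.
  Strict positivity comes from the term \<open>1/4\<close> if \<open>m = 1\<close>, and from the
  product with \<open>k = 2\<close> otherwise.\<close>

lemma bernoulli_fps_even_sign: "m \<ge> 1 \<Longrightarrow> (- 1) ^ (m - 1) * fps_nth bernoulli_fps_even (2 * m) > 0"
proof (induction m rule: less_induct)
  case (less m)
  let ?g = "fps_nth bernoulli_fps_even"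
  have neg: "(- 1) ^ (m - 1) * (?g k * ?g (2 * m - k)) \<le> 0" if k: "k \<in> {1..<2 * m}" for k
  proof (cases "odd k")
    case True
    then show ?thesis by (simp add: bernoulli_fps_even_odd)
  next
    case False
    then obtain i where i: "k = 2 * i" by auto
    define j where "j = m - i"
    have ij: "m = i + j" "i \<ge> 1" "j \<ge> 1" using k i by (auto simp: j_def)
    have "2 * m - k = 2 * j" using i ij by simp
    \<comment> \<open>The exponents of the two factors add up to one less than \<open>m - 1\<close>,
      which produces the minus sign.\<close>
    have "m - 1 = Suc ((i - 1) + (j - 1))" using ij by simp
    then have "(- 1) ^ (m - 1) * (?g k * ?g (2 * m - k))
        = - (((- 1) ^ (i - 1) * ?g (2 * i)) * ((- 1) ^ (j - 1) * ?g (2 * j)))"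
      unfolding \<open>2 * m - k = 2 * j\<close> unfolding i by (simp add: power_add)
    moreover have "(- 1) ^ (i - 1) * ?g (2 * i) > 0" "(- 1) ^ (j - 1) * ?g (2 * j) > 0"
      using less.IH[of i] less.IH[of j] ij by auto
    ultimately show ?thesis by (simp add: mult_pos_pos less_imp_le)
  qed
  have rec: "of_nat (2 * m + 1) * ((- 1) ^ (m - 1) * ?g (2 * m))
      = (- 1) ^ (m - 1) * (if 2 * m = 2 then 1 / 4 else 0)
        - (\<Sum>k=1..<2 * m. (- 1) ^ (m - 1) * (?g k * ?g (2 * m - k)))"
    using less.prems
    by (subst mult.left_commute, subst bernoulli_fps_even_rec)
      (simp_all only: right_diff_distrib sum_distrib_left)
  have "of_nat (2 * m + 1) * ((- 1) ^ (m - 1) * ?g (2 * m)) > 0"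
  proof (cases "m = 1")
    case True
    have "{Suc 0..<2} = {1}" by auto
    then show ?thesis unfolding rec using True by (simp add: bernoulli_fps_even_odd)
  next
    case False
    then have m: "m \<ge> 2" using less.prems by simp
    have e: "m - 1 = Suc (m - 2)" using m by simp
    have "(- 1) ^ (m - 1) * (?g 2 * ?g (2 * m - 2))
        = - (((- 1) ^ 0 * ?g (2 * 1)) * ((- 1) ^ (m - 1 - 1) * ?g (2 * (m - 1))))"
      unfolding diff_mult_distrib2[of 2 m 1] unfolding e by simp
    moreover have "(- 1) ^ 0 * ?g (2 * 1) > 0" "(- 1) ^ (m - 1 - 1) * ?g (2 * (m - 1)) > 0"
      using less.IH[of 1] less.IH[of "m - 1"] m by auto
    ultimately have "(- 1) ^ (m - 1) * (?g 2 * ?g (2 * m - 2)) < 0"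
      by (simp add: mult_pos_pos)
    then have "(\<Sum>k=1..<2 * m. (- 1) ^ (m - 1) * (?g k * ?g (2 * m - k))) < (\<Sum>k=1..<2 * m. 0)"
      using neg m by (intro sum_strict_mono_ex1) (auto intro!: bexI[of _ 2])
    then show ?thesis unfolding rec using False by simp
  qed
  then show ?case by (simp add: zero_less_mult_iff del: of_nat_add of_nat_mult of_nat_Suc)
qed

lemma bernoulli_sign:
  assumes "even n" "n > 0"
  shows "(- 1) ^ (n div 2 - 1) * bernoulli n > 0"
proof -
  obtain m where m: "n = 2 * m" using assms by blast
  \<comment> \<open>The even series differs from \<open>bernoulli_egf\<close> only in the
    coefficient of index 1.\<close>
  have "n \<noteq> 1" using m by auto
  then have "bernoulli n = fact n * fps_nth bernoulli_fps_even n"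
    by (simp add: bernoulli_def bernoulli_fps_even_def)
  moreover have "(- 1) ^ (m - 1) * fps_nth bernoulli_fps_even (2 * m) > 0"
    using bernoulli_fps_even_sign m assms by simp
  ultimately show ?thesis unfolding m by (simp add: mult.left_commute)
qed

section \<open>Generating function of the power sums and Faulhaber's formula\<close>

lemma power_sum_egf:
  "fps_X * (\<Sum>a<N. fps_exp (of_nat a)) = bernoulli_egf * (fps_exp (of_nat N) - 1)"
proof -
  \<comment> \<open>A geometric series in \<open>fps_exp 1\<close>; multiplication by the Bernoulli
    series then replaces \<open>fps_exp 1 - 1\<close> by \<open>fps_X\<close>.\<close>
  have "(fps_exp 1 - 1) * (\<Sum>a<N. fps_exp (1::rat) ^ a) = fps_exp 1 ^ N - 1"
    by (rule power_diff_1_eq[symmetric])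
  then have "(fps_exp 1 - 1) * (\<Sum>a<N. fps_exp (of_nat a)) = fps_exp (of_nat N :: rat) - 1"
    by (simp add: fps_exp_power_mult)
  then show ?thesis
    by (simp flip: bernoulli_egf_times add: mult.assoc)
qed

text \<open>Faulhaber's formula with the linear term split off, from the coefficients of index
  \<open>n + 1\<close> in \<open>power_sum_egf\<close>. All further terms contain
  \<open>N ^ 2\<close>, with coefficients independent of \<open>N\<close>.\<close>

lemma power_sum_bernoulli_series:
  "of_int (power_sum n N) = of_nat N * bernoulli n
     + of_nat N ^ 2 * (\<Sum>k<n. fact n * fps_nth bernoulli_egf (n - Suc k) / fact (k + 2) * of_nat N ^ k)"
proof -
  have "fps_nth (fps_X * (\<Sum>a<N. fps_exp (of_nat a))) (Suc n)
      = fps_nth ((fps_exp (of_nat N) - 1) * bernoulli_egf) (Suc n)"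
    by (simp only: power_sum_egf mult.commute)
  then have "(\<Sum>a<N. of_nat a ^ n / fact n)
      = (\<Sum>i=0..Suc n. fps_nth (fps_exp (of_nat N) - 1) i * fps_nth bernoulli_egf (Suc n - i))"
    unfolding fps_mult_nth[of "fps_exp (of_nat N) - 1"] by (simp add: fps_sum_nth)
  also have "\<dots> = (\<Sum>i=1..Suc n. of_nat N ^ i / fact i * fps_nth bernoulli_egf (Suc n - i))"
    by (simp add: sum.atLeast_Suc_atMost[of 0] del: sum.cl_ivl_Suc)
  also have "\<dots> = of_nat N * fps_nth bernoulli_egf n
      + (\<Sum>i=2..Suc n. of_nat N ^ i / fact i * fps_nth bernoulli_egf (Suc n - i))"
    by (subst sum.atLeast_Suc_atMost) (simp_all add: numeral_2_eq_2 del: sum.cl_ivl_Suc)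
  also have "(\<Sum>i=2..Suc n. of_nat N ^ i / fact i * fps_nth bernoulli_egf (Suc n - i))
      = (\<Sum>k<n. of_nat N ^ (k + 2) / fact (k + 2) * fps_nth bernoulli_egf (n - Suc k))"
    by (rule sum.reindex_bij_witness[of _ "\<lambda>k. k + 2" "\<lambda>i. i - 2"])
      (auto simp del: fact_Suc dest!: le_Suc_ex)
  finally have "fact n * (\<Sum>a<N. of_nat a ^ n / fact n)
      = fact n * (of_nat N * fps_nth bernoulli_egf n
      + (\<Sum>k<n. of_nat N ^ (k + 2) / fact (k + 2) * fps_nth bernoulli_egf (n - Suc k)))"
    by simp
  moreover have "fact n * (\<Sum>a<N. of_nat a ^ n / fact n) = (of_int (power_sum n N) :: rat)"
    by (simp add: power_sum_def flip: sum_divide_distrib)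
  ultimately show ?thesis
    by (simp add: bernoulli_def distrib_left sum_distrib_left power_add mult_ac power2_eq_square
      del: fact_Suc)
qed

lemma common_denominator:
  fixes c :: "nat \<Rightarrow> rat"
  shows "\<exists>D>0. \<forall>k<n. of_int D * c k \<in> \<int>"
proof (induction n)
  case (Suc n)
  then obtain D where D: "D > 0" "\<forall>k<n. of_int D * c k \<in> \<int>" by blast
  obtain a b where ab: "quotient_of (c n) = (a, b)" by fastforce
  have b: "b > 0" "c n = of_int a / of_int b"
    using quotient_of_denom_pos[OF ab] quotient_of_div[OF ab] by auto
  have "of_int (D * b) * c k \<in> \<int>" if k: "k < Suc n" for k
  proof (cases "k = n")
    case True
    have "of_int (D * b) * c n = of_int (D * a)" using b by simp
    then show ?thesis using True by (metis Ints_of_int)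
  next
    case False
    then have "of_int D * c k \<in> \<int>" using D k by simp
    then have "of_int b * (of_int D * c k) \<in> \<int>" by (rule Ints_mult[OF Ints_of_int])
    then show ?thesis by (simp add: mult_ac)
  qed
  then show ?case using D b by (intro exI[of _ "D * b"]) auto
qed (auto intro: exI[of _ 1])

text \<open>A single denominator \<open>D\<close> serves for all \<open>N\<close>, so that \<open>power_sum n N / N\<close> tends
  \<open>p\<close>-adically to \<open>B\<^sub>n\<close> when \<open>N\<close> runs through the powers of \<open>p\<close>.\<close>

lemma power_sum_bernoulli:
  "\<exists>D>0. \<forall>N. \<exists>z. of_int D * (of_int (power_sum n N) - of_nat N * bernoulli n) = of_nat N ^ 2 * of_int z"
proof -
  define c where "c k = fact n * fps_nth bernoulli_egf (n - Suc k) / fact (k + 2)" for k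
  obtain D where D: "D > 0" "\<forall>k<n. of_int D * c k \<in> \<int>"
    using common_denominator by blast
  have "\<exists>z. of_int D * (of_int (power_sum n N) - of_nat N * bernoulli n) = of_nat N ^ 2 * of_int z" for N
  proof -
    have "(\<Sum>k<n. of_int D * c k * of_nat N ^ k) \<in> \<int>"
      using D(2) by (intro Ints_sum Ints_mult[of "of_int D * c _"] Ints_power) auto
    then obtain z where z: "(\<Sum>k<n. of_int D * c k * of_nat N ^ k) = of_int z"
      by (elim Ints_cases)
    have "of_int D * (of_int (power_sum n N) - of_nat N * bernoulli n)
        = of_nat N ^ 2 * (of_int D * (\<Sum>k<n. c k * of_nat N ^ k))"
      unfolding power_sum_bernoulli_series c_def by simp
    also have "of_int D * (\<Sum>k<n. c k * of_nat N ^ k) = of_int z"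
      by (simp flip: z add: sum_distrib_left mult.assoc)
    finally show ?thesis by blast
  qed
  then show ?thesis using D(1) by blast
qed

subsection \<open>Congruences of von Staudt, Clausen and Voronoi\<close>

lemma square_dvd_power_expansion:
  fixes x y :: int
  shows "y ^ 2 dvd (x + y) ^ n - x ^ n - of_nat n * x ^ (n - 1) * y"
proof (induction n)
  case (Suc n)
  then obtain z where z: "(x + y) ^ n = x ^ n + of_nat n * x ^ (n - 1) * y + y ^ 2 * z"
    by (metis (no_types, lifting) add_diff_cancel_left' diff_diff_eq diff_add_cancel add.commute dvdE)
  \<comment> \<open>For \<open>n = 0\<close> the exponent \<open>n - 1\<close> truncates, but the
    factor \<open>n\<close> vanishes.\<close>
  have x: "of_nat n * x ^ (n - 1) * x = of_nat n * x ^ n"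
    by (cases n) auto
  have "(x + y) ^ Suc n - x ^ Suc n - of_nat (Suc n) * x ^ (Suc n - 1) * y
      = (of_nat n * x ^ (n - 1) * x - of_nat n * x ^ n) * y
        + y ^ 2 * (of_nat n * x ^ (n - 1) + z * (x + y))"
    by (simp add: z algebra_simps power2_eq_square)
  then show ?case unfolding x by simp
qed simp

text \<open>Write the summation index as \<open>u + N * v\<close> with \<open>u < N\<close> and
  \<open>v < p\<close>, and expand to first order in \<open>N * v\<close>. The error is divisible by
  \<open>N ^ 2\<close>. The linear terms contain the sum of all \<open>v < p\<close>, which is
  \<open>p * (p - 1) / 2\<close>; the even exponent supplies the missing factor 2.\<close>

lemma power_sum_mult:
  assumes "even n" "int p dvd int N"
  shows "int p * int N dvd power_sum n (p * N) - int p * power_sum n N"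
proof -
  define g where "g a = of_nat n * int a ^ (n - 1) * int N" for a
  have "power_sum n (p * N) = (\<Sum>v<p. \<Sum>a = v * N..<v * N + N. int a ^ n)"
    unfolding power_sum_def by (rule sum.nat_group[symmetric])
  also have "\<dots> = (\<Sum>v<p. \<Sum>u<N. int (u + N * v) ^ n)"
  proof (rule sum.cong[OF refl])
    fix v
    show "(\<Sum>a = v * N..<v * N + N. int a ^ n) = (\<Sum>u<N. int (u + N * v) ^ n)"
      using sum.shift_bounds_nat_ivl[of "\<lambda>a. int a ^ n" 0 "v * N" N]
      by (simp add: add.commute mult.commute lessThan_atLeast0)
  qed
  finally have S: "power_sum n (p * N) = (\<Sum>v<p. \<Sum>u<N. int (u + N * v) ^ n)" .
  have d: "int p * int N dvd int (u + N * v) ^ n - (int u ^ n + g u * int v)" for u v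
  proof -
    have "int p * int N dvd int N ^ 2" using assms(2) by (simp add: power2_eq_square)
    also have "int N ^ 2 dvd (int N * int v) ^ 2" by (simp add: power_mult_distrib)
    also have "(int N * int v) ^ 2 dvd (int u + int N * int v) ^ n - int u ^ n
        - of_nat n * int u ^ (n - 1) * (int N * int v)"
      by (rule square_dvd_power_expansion)
    finally show ?thesis by (simp add: g_def algebra_simps)
  qed
  have "int p * int N dvd (\<Sum>v<p. \<Sum>u<N. int (u + N * v) ^ n - (int u ^ n + g u * int v))"
    by (intro dvd_sum d)
  also have "(\<Sum>v<p. \<Sum>u<N. int (u + N * v) ^ n - (int u ^ n + g u * int v))
      = power_sum n (p * N) - int p * power_sum n N - (\<Sum>u<N. g u) * (\<Sum>v<p. int v)"
    unfolding S by (simp add: sum_subtractf sum.distrib power_sum_def sum_product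
        sum.swap[of _ "{..<p}" "{..<N}"])
  finally have 1: "int p * int N dvd power_sum n (p * N) - int p * power_sum n N - (\<Sum>u<N. g u) * (\<Sum>v<p. int v)" .
  obtain m where m: "n = 2 * m" using assms(1) by blast
  have gauss: "2 * (\<Sum>v<p. int v) = int p * (int p - 1)"
    by (induction p) (auto simp: algebra_simps)
  have "(\<Sum>u<N. g u) * (\<Sum>v<p. int v)
      = (\<Sum>u<N. of_nat m * int u ^ (n - 1) * int N) * (2 * (\<Sum>v<p. int v))"
    by (simp add: g_def m sum_distrib_left sum_distrib_right mult_ac)
  also have "\<dots> = int p * int N * ((\<Sum>u<N. of_nat m * int u ^ (n - 1)) * (int p - 1))"
    unfolding gauss by (simp add: sum_distrib_right sum_distrib_left mult_ac)
  finally have 2: "int p * int N dvd (\<Sum>u<N. g u) * (\<Sum>v<p. int v)" by simp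
  show ?thesis using dvd_add[OF 1 2] by simp
qed

section \<open>Power sums over powers of \<open>p\<close> and the von Staudt-Clausen theorem\<close>

context rat_adic
begin

text \<open>A fixed denominator is absorbed by a high power of \<open>p\<close>. The bound
  \<open>M0\<close> is chosen before \<open>z\<close>, because \<open>z\<close> depends on
  \<open>M\<close> in the applications.\<close>

lemma pd_eventually:
  assumes "D \<noteq> 0"
  shows "\<exists>M0. \<forall>M\<ge>M0. \<forall>z. pd k (of_nat p ^ M * of_int z / of_int D)"
proof -
  define m where "m = multiplicity (int p) D"
  obtain D' where D': "D = int p ^ m * D'" "\<not> int p dvd D'"
    using multiplicity_decompose'[of D "int p"] assms prime_int m_def by (metis not_prime_unit)
  have D'0: "D' \<noteq> 0" using D'(2) by auto
  have "pd k (of_nat p ^ M * of_int z / of_int D)" if "M \<ge> k + m" for M z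
  proof -
    obtain j where j: "M = k + m + j" using \<open>M \<ge> k + m\<close> by (auto dest: le_Suc_ex)
    have "(of_nat p ^ M * of_int z / of_int D :: rat) * of_int D' = of_int (int p ^ k * (int p ^ j * z))"
      unfolding j by (subst D'(1)) (use D'0 p_pos in \<open>simp add: power_add\<close>)
    then show ?thesis using D'(2) pdI by blast
  qed
  then show ?thesis by blast
qed

text \<open>Iteration of \<open>power_sum_mult\<close>. Divided by \<open>p ^ M\<close>, it says
  that the means of the power sums over \<open>p ^ M\<close> and over \<open>p\<close> differ by an
  integer.\<close>

lemma power_sum_prime_power:
  assumes "even n" "M \<ge> 1"
  shows "int p ^ M dvd power_sum n (p ^ M) - int p ^ (M - 1) * power_sum n p"
  using assms(2)
proof (induction M rule: dec_induct)
  case (step M)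
  have "int p ^ Suc M dvd power_sum n (p ^ Suc M) - int p * power_sum n (p ^ M)"
    using power_sum_mult[OF assms(1), of p "p ^ M"] step.hyps by simp
  moreover have "int p ^ Suc M dvd int p * (power_sum n (p ^ M) - int p ^ (M - 1) * power_sum n p)"
    using step.IH by simp
  ultimately have "int p ^ Suc M dvd (power_sum n (p ^ Suc M) - int p * power_sum n (p ^ M))
      + int p * (power_sum n (p ^ M) - int p ^ (M - 1) * power_sum n p)"
    by (rule dvd_add)
  also have "\<dots> = power_sum n (p ^ Suc M) - int p * int p ^ (M - 1) * power_sum n p"
    by (simp add: algebra_simps)
  also have "int p * int p ^ (M - 1) = int p ^ (Suc M - 1)"
    using step.hyps by (simp flip: power_Suc)
  finally show ?case .
qed simp

text \<open>The quotient \<open>power_sum n (p ^ M) / p ^ M\<close> is \<open>p\<close>-adically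
  close to \<open>bernoulli n\<close> for large \<open>M\<close>, and differs by an integer from the
  same quotient at \<open>M = 1\<close>.\<close>

lemma bernoulli_power_sum_prime:
  assumes "even n"
  shows "pd 0 (bernoulli n - of_int (power_sum n p) / of_nat p)"
proof -
  obtain D where D: "D > 0" and
    B: "\<And>N. \<exists>z. of_int D * (of_int (power_sum n N) - of_nat N * bernoulli n) = of_nat N ^ 2 * of_int z"
    using power_sum_bernoulli by blast
  obtain M0 where M0: "\<And>M z. M \<ge> M0 \<Longrightarrow> pd 0 (of_nat p ^ M * of_int z / of_int D)"
    using pd_eventually[of D 0] D by auto
  \<comment> \<open>The successor ensures \<open>M \<ge> 1\<close>, as the comparison with the power
    sum over \<open>p\<close> requires.\<close>
  define M where "M = Suc M0"
  obtain z where z: "of_int D * (of_int (power_sum n (p ^ M)) - of_nat (p ^ M) * bernoulli n)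
      = of_nat (p ^ M) ^ 2 * of_int z"
    using B by blast
  define q where "q = (of_nat p ^ M :: rat)"
  have q: "q \<noteq> 0" using p_pos by (simp add: q_def)
  have zq: "of_int D * (of_int (power_sum n (p ^ M)) - q * bernoulli n) = q ^ 2 * of_int z"
    using z by (simp add: q_def)
  then have "of_int (power_sum n (p ^ M)) / q - bernoulli n = q * of_int z / of_int D"
    using q D by (simp add: field_simps power2_eq_square)
  then have 1: "pd 0 (of_int (power_sum n (p ^ M)) / q - bernoulli n)"
    using M0[of M z] by (simp add: M_def q_def)
  obtain w where w: "power_sum n (p ^ M) - int p ^ (M - 1) * power_sum n p = int p ^ M * w"
    using power_sum_prime_power[OF assms, of M] by (auto simp: M_def elim!: dvdE)
  have qp: "q = of_nat p * of_nat p ^ (M - 1)" by (simp add: q_def M_def)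
  have "of_int (power_sum n (p ^ M)) = of_nat p ^ (M - 1) * of_int (power_sum n p) + q * of_int w"
    using arg_cong[OF w, of "of_int :: int \<Rightarrow> rat"] by (simp add: q_def diff_eq_eq add.commute)
  then have "of_int (power_sum n (p ^ M)) / q - of_int (power_sum n p) / of_nat p = of_int w"
    using q p_pos unfolding qp by (simp add: field_simps)
  then have 2: "pd 0 (of_int (power_sum n (p ^ M)) / q - of_int (power_sum n p) / of_nat p)"
    by (simp add: pd_of_int)
  show ?thesis using pd_diff[OF 2 1] by simp
qed

lemma fermat_int:
  assumes "\<not> int p dvd x"
  shows "int p dvd x ^ (p - 1) - 1"
proof -
  define y where "y = nat (x mod int p)"
  have y: "int y = x mod int p" using p_pos by (simp add: y_def)
  then have "\<not> p dvd y" using assms by (metis dvd_imp_mod_0 dvd_mod_iff int_dvd_int_iff dvd_refl)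
  then have "[y ^ (p - 1) = 1] (mod p)" using fermat_theorem prime_p by blast
  then have "[int y ^ (p - 1) = 1] (mod int p)"
    by (metis cong_int_iff of_nat_1 of_nat_power)
  moreover have "[x ^ (p - 1) = int y ^ (p - 1)] (mod int p)"
    by (rule cong_pow) (simp add: y cong_def)
  ultimately show ?thesis using cong_iff_dvd_diff cong_trans by blast
qed

text \<open>By Fermat each of the \<open>p - 1\<close> terms with nonzero base is 1 modulo
  \<open>p\<close>; the base 0 contributes nothing because \<open>n > 0\<close>.\<close>

lemma power_sum_prime_cong:
  assumes "(p - 1) dvd n" "n > 0"
  shows "int p dvd power_sum n p + 1"
proof -
  obtain m where m: "n = (p - 1) * m" using assms by blast
  have d: "int p dvd int a ^ n - 1" if "a \<in> {1..<p}" for a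
  proof -
    have "\<not> int p dvd int a" using that nat_dvd_not_less by auto
    then have "int p dvd int a ^ (p - 1) - 1" by (rule fermat_int)
    also have "int a ^ (p - 1) - 1 dvd (int a ^ (p - 1)) ^ m - 1"
      using power_diff_1_eq[of "int a ^ (p - 1)" m] by simp
    finally show ?thesis by (simp add: m power_mult)
  qed
  have "{..<p} = insert 0 {1..<p}" using p_pos by auto
  then have "power_sum n p = (\<Sum>a\<in>{1..<p}. int a ^ n)"
    using assms(2) by (simp add: power_sum_def)
  then have "power_sum n p + 1 = (\<Sum>a\<in>{1..<p}. int a ^ n - 1) + int p"
    using p_gt_1 by (simp add: sum_subtractf of_nat_diff)
  moreover have "int p dvd (\<Sum>a\<in>{1..<p}. int a ^ n - 1)" using d by (rule dvd_sum)
  ultimately show ?thesis by simp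
qed

text \<open>Modulo \<open>p\<close>, the number \<open>p * bernoulli n\<close> agrees with
  \<open>power_sum n p\<close>, hence with \<open>- 1\<close>; so it is a \<open>p\<close>-adic
  unit.\<close>

lemma von_staudt_clausen_ord:
  assumes "even n" "n > 0" "(p - 1) dvd n"
  shows "rat_ord p (bernoulli n) = - 1"
proof -
  obtain w where "power_sum n p + 1 = int p * w"
    using power_sum_prime_cong[OF assms(3,2)] by blast
  then have w: "power_sum n p = int p * w - 1" by simp
  obtain y where y: "pd 0 y" "y = bernoulli n - of_int (power_sum n p) / of_nat p"
    using bernoulli_power_sum_prime[OF assms(1)] by blast
  have "of_nat p * bernoulli n = of_nat p * (y + of_int w) - 1"
    unfolding y(2) w using p_pos by (simp add: field_simps)
  moreover have "pd 1 (of_nat p * (y + of_int w))"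
    using pd_mult[of 1 "of_nat p" 0 "y + of_int w"] pd_add[OF y(1), of "of_int w"] pd_of_int[of 0 w] pd_of_nat[of 1 p]
    by simp
  moreover have "\<not> pd 1 1" using pd_of_int[of 1 1] prime_int not_prime_unit by auto
  moreover have "pd 0 1" using pd_of_int[of 0 1] by simp
  ultimately have "pd 0 (of_nat p * bernoulli n)" "\<not> pd 1 (of_nat p * bernoulli n)"
    using pd_diff[of 0 "of_nat p * (y + of_int w)" 1] pd_mono[of 1 "of_nat p * (y + of_int w)" 0]
      pd_cong[of 1 "of_nat p * (y + of_int w)" 1] pd_diff[of 1 "of_nat p * (y + of_int w)" "of_nat p * bernoulli n"]
    by auto
  then have "rat_ord p (of_nat p * bernoulli n) = 0" "bernoulli n \<noteq> 0"
    unfolding pow_dvd_rat_def by auto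
  moreover have "rat_ord p (of_nat p) = 1"
    using rat_ord_of_nat[of p] p_pos prime_p by simp
  ultimately show ?thesis using rat_ord_mult[of "of_nat p" "bernoulli n"] p_pos by simp
qed

section \<open>Voronoi's congruence\<close>

definition euler_quotient :: "nat \<Rightarrow> rat" where
  "euler_quotient n = (1 - of_nat p ^ (n - 1)) * bernoulli n / of_nat n"

definition units :: "nat \<Rightarrow> nat set" where
  "units M = {a. a < p ^ M \<and> \<not> p dvd a}"

lemma finite_units [simp]: "finite (units M)"
  by (simp add: units_def)

text \<open>The non-units below \<open>p ^ M\<close> are the numbers \<open>p * b\<close> with
  \<open>b < p ^ (M - 1)\<close>. In the limit of large \<open>M\<close> their removal produces the
  factor \<open>1 - p ^ (n - 1)\<close> of \<open>euler_quotient\<close>, that is, the zeta value at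
  \<open>1 - n\<close>, up to sign, without its Euler factor at \<open>p\<close>.\<close>

lemma unit_power_sum:
  assumes "M \<ge> 1"
  shows "(\<Sum>a\<in>units M. int a ^ n) = power_sum n (p ^ M) - int p ^ n * power_sum n (p ^ (M - 1))"
proof -
  have e: "p ^ M = p * p ^ (M - 1)" using assms by (cases M) auto
  have "{..<p ^ M} = units M \<union> (\<lambda>b. p * b) ` {..<p ^ (M - 1)}"
    unfolding units_def e using p_pos by (auto elim!: dvdE)
  moreover have "units M \<inter> (\<lambda>b. p * b) ` {..<p ^ (M - 1)} = {}"
    by (auto simp: units_def)
  ultimately have "power_sum n (p ^ M)
      = (\<Sum>a\<in>units M. int a ^ n) + (\<Sum>a\<in>(\<lambda>b. p * b) ` {..<p ^ (M - 1)}. int a ^ n)"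
    unfolding power_sum_def by (simp add: sum.union_disjoint)
  also have "(\<Sum>a\<in>(\<lambda>b. p * b) ` {..<p ^ (M - 1)}. int a ^ n) = int p ^ n * power_sum n (p ^ (M - 1))"
    using p_pos by (subst sum.reindex)
      (auto simp: inj_on_def power_sum_def sum_distrib_left power_mult_distrib)
  finally show ?thesis by simp
qed

lemma bij_betw_units:
  assumes "coprime c p" "M \<ge> 1"
  shows "bij_betw (\<lambda>a. c * a mod p ^ M) (units M) (units M)"
proof -
  have cop: "coprime c (p ^ M)" using assms by simp
  have pd: "p dvd p ^ M" using assms by simp
  have "inj_on (\<lambda>a. c * a mod p ^ M) (units M)"
  proof (rule inj_onI)
    fix a b assume "a \<in> units M" "b \<in> units M" "c * a mod p ^ M = c * b mod p ^ M"
    then have "[c * a = c * b] (mod p ^ M)" "a < p ^ M" "b < p ^ M"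
      by (auto simp: cong_def units_def)
    then show "a = b" using cop cong_mult_lcancel_nat cong_less_modulus_unique_nat by blast
  qed
  moreover have "(\<lambda>a. c * a mod p ^ M) ` units M \<subseteq> units M"
  proof (rule image_subsetI)
    fix a assume "a \<in> units M"
    then have "\<not> p dvd c * a"
      using assms(1) by (auto simp: units_def coprime_dvd_mult_right_iff coprime_commute)
    then have "\<not> p dvd c * a mod p ^ M" using pd by (simp add: dvd_mod_iff)
    then show "c * a mod p ^ M \<in> units M" using p_pos by (simp add: units_def)
  qed
  ultimately show ?thesis
    using endo_inj_surj[of "units M"] by (simp add: bij_betw_def)
qed

text \<open>The exponent \<open>n - 1\<close> falls on numbers prime to \<open>p\<close> when
  \<open>c\<close> is prime to \<open>p\<close>, so that the dependence on \<open>n\<close> can be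
  controlled by Fermat's theorem.\<close>

definition voronoi_sum :: "nat \<Rightarrow> nat \<Rightarrow> nat \<Rightarrow> int" where
  "voronoi_sum c M n = (\<Sum>a\<in>units M. int (c * a div p ^ M) * int (c * a) ^ (n - 1))"

text \<open>Voronoi's argument: expand \<open>(c a mod p\<^sup>M)\<^sup>n\<close> around \<open>c a\<close> modulo \<open>p\<^sup>2\<^sup>M\<close>, and use that
  \<open>a \<mapsto> c a mod p\<^sup>M\<close> permutes the units.\<close>

lemma voronoi_int:
  assumes "coprime c p" "M \<ge> 1"
  shows "int p ^ (2 * M) dvd (int c ^ n - 1) * (\<Sum>a\<in>units M. int a ^ n)
            - int n * int p ^ M * voronoi_sum c M n"
proof -
  let ?N = "int p ^ M"
  have d: "?N ^ 2 dvd int (c * a mod p ^ M) ^ n - int (c * a) ^ n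
      + int n * ?N * (int (c * a div p ^ M) * int (c * a) ^ (n - 1))" for a
  proof -
    define y where "y = - (?N * int (c * a div p ^ M))"
    have "int (c * a) = int (c * a mod p ^ M + p ^ M * (c * a div p ^ M))" by simp
    then have r: "int (c * a mod p ^ M) = int (c * a) + y"
      unfolding y_def of_nat_add of_nat_mult of_nat_power by linarith
    have "?N ^ 2 dvd y ^ 2" by (simp add: y_def power_mult_distrib)
    also have "y ^ 2 dvd (int (c * a) + y) ^ n - int (c * a) ^ n - of_nat n * int (c * a) ^ (n - 1) * y"
      by (rule square_dvd_power_expansion)
    finally show ?thesis unfolding r[symmetric] by (simp add: y_def algebra_simps)
  qed
  have "?N ^ 2 dvd (\<Sum>a\<in>units M. int (c * a mod p ^ M) ^ n - int (c * a) ^ n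
      + int n * ?N * (int (c * a div p ^ M) * int (c * a) ^ (n - 1)))"
    by (intro dvd_sum d)
  also have "\<dots> = (\<Sum>a\<in>units M. int (c * a mod p ^ M) ^ n) - int c ^ n * (\<Sum>a\<in>units M. int a ^ n)
      + int n * ?N * voronoi_sum c M n"
    by (simp add: sum.distrib sum_subtractf voronoi_sum_def sum_distrib_left power_mult_distrib)
  also have "(\<Sum>a\<in>units M. int (c * a mod p ^ M) ^ n) = (\<Sum>a\<in>units M. int a ^ n)"
    by (rule sum.reindex_bij_betw[OF bij_betw_units[OF assms], of "\<lambda>a. int a ^ n"])
  finally have "?N ^ 2 dvd - ((int c ^ n - 1) * (\<Sum>a\<in>units M. int a ^ n)
            - int n * int p ^ M * voronoi_sum c M n)"
    by (simp add: algebra_simps)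
  then show ?thesis by (simp add: power_mult mult.commute[of 2] del: minus_diff_eq)
qed

text \<open>Divide \<open>voronoi_int\<close> by \<open>n * p ^ M\<close>. The unit power sum
  divided by \<open>p ^ M\<close> tends to \<open>n * euler_quotient n\<close>, and the error in
  \<open>voronoi_int\<close> keeps a factor \<open>p ^ M\<close>. The denominators \<open>D\<close>
  and \<open>n\<close> are fixed, so every precision is reached.\<close>

lemma voronoi:
  assumes "coprime c p" "n \<ge> 1"
  shows "\<exists>M0. \<forall>M\<ge>M0. pd k ((of_nat c ^ n - 1) * euler_quotient n - of_int (voronoi_sum c M n))"
proof -
  obtain D where D: "D > 0" and
    B: "\<And>N. \<exists>z. of_int D * (of_int (power_sum n N) - of_nat N * bernoulli n) = of_nat N ^ 2 * of_int z"
    using power_sum_bernoulli by blast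
  obtain M0 where M0: "\<And>M z. M \<ge> M0 \<Longrightarrow> pd k (of_nat p ^ M * of_int z / of_int (D * int n))"
    using pd_eventually[of "D * int n" k] D assms(2) by auto
  have "pd k ((of_nat c ^ n - 1) * euler_quotient n - of_int (voronoi_sum c M n))" if M: "M \<ge> M0 + 2" for M
  proof -
    \<comment> \<open>Two powers of \<open>p\<close> are given away: the error of the power sum over
      \<open>p ^ (M - 1)\<close> carries only \<open>p ^ (2 * M - 2)\<close>, which leaves
      \<open>p ^ (M - 2)\<close> after division by \<open>p ^ M\<close>.\<close>
    define m where "m = M - 2"
    have m: "M = Suc (Suc m)" "m \<ge> M0" using M by (auto simp: m_def)
    define P where "P = (of_nat p :: rat)"
    define q where "q = P ^ m"
    define b where "b = bernoulli n"
    define T where "T = (of_int (\<Sum>a\<in>units M. int a ^ n) :: rat)"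
    define V where "V = (of_int (voronoi_sum c M n) :: rat)"
    define C where "C = (of_nat c ^ n - 1 :: rat)"
    define d where "d = (of_int D :: rat)"
    define e where "e = (of_nat n :: rat)"
    have nz: "q \<noteq> 0" "P \<noteq> 0" "d \<noteq> 0" "e \<noteq> 0" using p_pos D assms(2) by (auto simp: q_def P_def d_def e_def)
    obtain z1 where "d * (of_int (power_sum n (p ^ M)) - of_nat (p ^ M) * b) = of_nat (p ^ M) ^ 2 * of_int z1"
      using B[of "p ^ M"] unfolding b_def d_def by blast
    moreover have qM: "of_nat (p ^ M) = P ^ 2 * q" by (simp add: m P_def q_def power2_eq_square)
    ultimately have z1: "d * of_int (power_sum n (p ^ M)) = d * (P ^ 2 * q * b) + (P ^ 2 * q) ^ 2 * of_int z1"
      unfolding right_diff_distrib by simp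
    obtain z2 where "d * (of_int (power_sum n (p ^ (M - 1))) - of_nat (p ^ (M - 1)) * b)
        = of_nat (p ^ (M - 1)) ^ 2 * of_int z2"
      using B[of "p ^ (M - 1)"] unfolding b_def d_def by blast
    moreover have "of_nat (p ^ (M - 1)) = P * q" by (simp add: m P_def q_def)
    ultimately have z2: "d * of_int (power_sum n (p ^ (M - 1))) = d * (P * q * b) + (P * q) ^ 2 * of_int z2"
      unfolding right_diff_distrib by simp
    have T: "T = of_int (power_sum n (p ^ M)) - P ^ n * of_int (power_sum n (p ^ (M - 1)))"
      unfolding T_def using unit_power_sum[of M n] by (simp add: m P_def)
    have Pn: "P ^ n = P * P ^ (n - 1)" using assms(2) by (cases n) auto
    define X where "X = P ^ 2 * of_int z1 - P ^ n * of_int z2"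
    define R where "R = 1 - P ^ (n - 1)"
    have "d * T = d * of_int (power_sum n (p ^ M)) - P ^ n * (d * of_int (power_sum n (p ^ (M - 1))))"
      unfolding T by (simp add: right_diff_distrib mult.left_commute)
    also have "\<dots> = d * (P ^ 2 * q * b) - P ^ n * (d * (P * q * b)) + P ^ 2 * q ^ 2 * X"
      unfolding z1 z2 X_def by (simp add: right_diff_distrib distrib_left power_mult_distrib power2_eq_square mult_ac)
    also have "P ^ n * (d * (P * q * b)) = d * P ^ 2 * q * P ^ (n - 1) * b"
      unfolding Pn by (simp add: power2_eq_square mult_ac)
    finally have dT: "d * T = d * P ^ 2 * q * R * b + P ^ 2 * q ^ 2 * X"
      unfolding R_def by (simp add: right_diff_distrib left_diff_distrib mult_ac)
    obtain w where "(int c ^ n - 1) * (\<Sum>a\<in>units M. int a ^ n) - int n * int p ^ M * voronoi_sum c M n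
        = int p ^ (2 * M) * w"
      using voronoi_int[OF assms(1), of M n] m(1) by (auto elim!: dvdE)
    then have "of_int ((int c ^ n - 1) * (\<Sum>a\<in>units M. int a ^ n) - int n * int p ^ M * voronoi_sum c M n)
        = (of_int (int p ^ (2 * M) * w) :: rat)" by (simp only:)
    moreover have "of_int (int p ^ M) = P ^ 2 * q" using qM by simp
    moreover have "of_int (int p ^ (2 * M)) = (P ^ 2 * q) ^ 2"
      using qM by (simp add: power_mult mult.commute[of 2])
    ultimately have w: "C * T - e * (P ^ 2 * q) * V = (P ^ 2 * q) ^ 2 * of_int w"
      unfolding of_int_diff of_int_mult C_def T_def V_def e_def by simp
    \<comment> \<open>\<open>y\<close> collects the errors of the two power sums and of
      \<open>voronoi_int\<close>, with denominators cleared.\<close>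
    define y where "y = D * int p ^ 2 * w - (int c ^ n - 1) * (int p ^ 2 * z1 - int p ^ n * z2)"
    have y: "of_int y = d * P ^ 2 * of_int w - C * X"
      by (simp add: y_def d_def P_def C_def X_def)
    have "P ^ 2 * q * (C * R * b * d - e * d * V)
        = C * (d * P ^ 2 * q * R * b) - d * (e * (P ^ 2 * q) * V)"
      by (simp add: algebra_simps)
    also have "d * P ^ 2 * q * R * b = d * T - P ^ 2 * q ^ 2 * X"
      using dT by simp
    also have "e * (P ^ 2 * q) * V = C * T - (P ^ 2 * q) ^ 2 * of_int w" using w by simp
    also have "C * (d * T - P ^ 2 * q ^ 2 * X) - d * (C * T - (P ^ 2 * q) ^ 2 * of_int w)
        = P ^ 2 * q * (q * of_int y)"
      unfolding y by (simp add: algebra_simps power2_eq_square)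
    finally have "C * R * b * d - e * d * V = q * of_int y"
      using nz by simp
    then have "C * (R * b / e) - V = q * of_int y / (d * e)"
      using nz by (simp add: diff_divide_eq_iff eq_divide_eq mult_ac right_diff_distrib)
    then have "C * euler_quotient n - V = of_nat p ^ m * of_int y / of_int (D * int n)"
      by (simp add: euler_quotient_def R_def P_def q_def b_def d_def e_def)
    then show ?thesis using M0[OF m(2), of y] by (simp add: C_def V_def)
  qed
  then show ?thesis by blast
qed

end

subsection \<open>Kummer congruences\<close>

context rat_adic
begin

lemma not_dvd_iff_coprime: "\<not> p dvd c \<longleftrightarrow> coprime c p"
  using prime_p by (metis coprime_commute not_prime_unit coprime_absorb_left prime_imp_coprime)

text \<open>Beyond the linear term, \<open>k = 2\<close> gives \<open>p ^ (2 * v + 1)\<close>, as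
  \<open>p\<close> divides the binomial coefficient for odd \<open>p\<close>, and
  \<open>k \<ge> 3\<close> gives at least \<open>p ^ (3 * v)\<close>. Both exponents reach
  \<open>v + 2\<close> because \<open>v \<ge> 1\<close>.\<close>

lemma power_prime_linear:
  fixes w :: int
  assumes "odd p" "v \<ge> 1" "int p ^ v dvd w"
  shows "int p ^ (v + 2) dvd (1 + w) ^ p - 1 - int p * w"
proof -
  have p3: "p \<ge> 3" using assms(1) p_gt_1 by (cases "p = 2") auto
  have d: "int p ^ (v + 2) dvd int (p choose k) * w ^ k" if k: "k \<in> {2..p}" for k
  proof (cases "k = 2")
    case True
    have "p dvd p choose 2" using prime_p p3 by (intro dvd_choose_prime) auto
    then have "int p dvd int (p choose 2)" by simp
    moreover have "int p ^ (v * 2) dvd w ^ 2" using dvd_power_same[OF assms(3), of 2] by (simp add: power_mult)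
    ultimately have "int p * int p ^ (v * 2) dvd int (p choose 2) * w ^ 2" by (rule mult_dvd_mono)
    moreover have "int p ^ (v + 2) dvd int p * int p ^ (v * 2)"
      unfolding power_Suc[symmetric] using assms(2) by (intro le_imp_power_dvd) simp
    ultimately show ?thesis using True dvd_trans by blast
  next
    case False
    then have "k \<ge> 3" using k by auto
    then have "v * 3 \<le> v * k" by (rule mult_le_mono2)
    then have "int p ^ (v + 2) dvd int p ^ (v * k)" using assms(2) by (intro le_imp_power_dvd) linarith
    also have "int p ^ (v * k) dvd w ^ k" using dvd_power_same[OF assms(3), of k] by (simp add: power_mult)
    finally show ?thesis by simp
  qed
  have "(1 + w) ^ p = (\<Sum>k\<le>p. of_nat (p choose k) * w ^ k)"
    using binomial_ring[of w 1 p] by (simp add: add.commute)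
  also have "{..p} = insert 0 (insert 1 {2..p})" using p3 by auto
  finally have eq: "(1 + w) ^ p - 1 - int p * w = (\<Sum>k\<in>{2..p}. int (p choose k) * w ^ k)"
    by simp
  show ?thesis unfolding eq using d by (rule dvd_sum)
qed

text \<open>Induction on \<open>v\<close>: taking a \<open>p\<close>-th power multiplies the linear
  term by \<open>p\<close> and gains one power of \<open>p\<close> in the error, by
  \<open>power_prime_linear\<close>. At \<open>v = 0\<close> the error is a multiple of
  \<open>(y - 1) ^ 2\<close>.\<close>

lemma power_linear_approx:
  fixes y :: int
  assumes "odd p" "int p dvd y - 1" "p ^ v dvd t"
  shows "int p ^ (v + 2) dvd y ^ t - 1 - int t * (y - 1)"
  using assms(3)
proof (induction v arbitrary: t)
  case 0
  have "int p ^ 2 dvd (y - 1) ^ 2" using assms(2) by (rule dvd_power_same)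
  also have "\<dots> dvd (1 + (y - 1)) ^ t - 1 ^ t - of_nat t * 1 ^ (t - 1) * (y - 1)"
    by (rule square_dvd_power_expansion)
  finally show ?case by (simp add: power2_eq_square)
next
  case (Suc v)
  then obtain t' where t: "t = p * t'" by (metis dvd_def mult.assoc power_Suc)
  then have "p ^ v dvd t'" using Suc.prems p_pos by simp
  then have IH: "int p ^ (v + 2) dvd y ^ t' - 1 - int t' * (y - 1)" by (rule Suc.IH)
  \<comment> \<open>\<open>w\<close> is divisible by \<open>p ^ Suc v\<close>: its linear term has
    \<open>p ^ v\<close> from \<open>t'\<close> and one more \<open>p\<close> from
    \<open>y - 1\<close>.\<close>
  define w where "w = y ^ t' - 1"
  have "int p ^ v dvd int t'" using \<open>p ^ v dvd t'\<close> by (simp flip: of_nat_power)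
  then have "int p ^ v * int p dvd int t' * (y - 1)" using assms(2) by (rule mult_dvd_mono)
  then have "int p ^ Suc v dvd int t' * (y - 1)" by (simp add: mult.commute)
  moreover have "int p ^ Suc v dvd w - int t' * (y - 1)"
    unfolding w_def by (rule dvd_trans[OF _ IH]) (simp add: le_imp_power_dvd)
  ultimately have "int p ^ Suc v dvd w"
    using dvd_add[of _ "int t' * (y - 1)" "w - int t' * (y - 1)"] by simp
  then have "int p ^ (Suc v + 2) dvd (1 + w) ^ p - 1 - int p * w"
    using assms(1) by (intro power_prime_linear) auto
  moreover have "int p ^ (Suc v + 2) dvd int p * (w - int t' * (y - 1))"
    using IH by (simp add: w_def)
  ultimately have "int p ^ (Suc v + 2) dvd ((1 + w) ^ p - 1 - int p * w) + int p * (w - int t' * (y - 1))"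
    by (rule dvd_add)
  also have "\<dots> = (1 + w) ^ p - 1 - int t * (y - 1)" by (simp add: t algebra_simps)
  also have "(1 + w) ^ p = y ^ t" by (simp add: w_def t power_mult[symmetric] mult.commute)
  finally show ?case .
qed

text \<open>The factor \<open>c ^ n - 1\<close> in Voronoi's congruence becomes a constant on a residue class
  modulo \<open>p - 1\<close> when \<open>c\<close> is a high \<open>p\<close>-power of a primitive root, since then
  \<open>c ^ (p - 1)\<close> is close to \<open>1\<close>.\<close>

lemma euler_quotient_voronoi:
  assumes "\<not> (p - 1) dvd l" "finite N" "\<And>n. n \<in> N \<Longrightarrow> n \<ge> 1 \<and> [n = l] (mod (p - 1))"
  obtains u c M where "\<not> int p dvd u" "coprime c p"
    "\<And>n. n \<in> N \<Longrightarrow> pd 0 (euler_quotient n)"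
    "\<And>n. n \<in> N \<Longrightarrow> pd K (of_int u * euler_quotient n - of_int (voronoi_sum c M n))"
proof -
  obtain b where "residue_primroot p b"
    using prime_primitive_root_exists prime_p p_gt_1 by blast
  then have b: "coprime p b" "ord p b = p - 1"
    using prime_p by (auto simp: residue_primroot_def totient_prime)
  define c where "c = b ^ (p ^ K)"
  have cp: "coprime c p" using b by (simp add: c_def coprime_commute)
  have "[b ^ totient (p ^ Suc K) = 1] (mod p ^ Suc K)"
    using b by (intro euler_theorem) (simp add: coprime_commute)
  then have "[c ^ (p - 1) = 1] (mod p ^ Suc K)"
    using prime_p totient_prime_power_Suc[of p K] by (simp only: c_def power_mult[symmetric])
  then have "ord (p ^ Suc K) c dvd p - 1" by (simp only: ord_divides)
  then have cc: "[c ^ n = c ^ l] (mod p ^ Suc K)" if "[n = l] (mod (p - 1))" for n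
  proof -
    have "coprime (p ^ Suc K) c" using cp by (simp add: coprime_commute)
    moreover have "[n = l] (mod ord (p ^ Suc K) c)"
      using that \<open>ord (p ^ Suc K) c dvd p - 1\<close> by (rule cong_dvd_modulus_nat)
    ultimately show ?thesis using order_divides_expdiff by blast
  qed
  \<comment> \<open>Hence \<open>c\<close> agrees with the primitive root \<open>b\<close> modulo
    \<open>p\<close>, and \<open>c ^ n - 1\<close> is a unit whenever \<open>p - 1\<close> does not
    divide \<open>n\<close>.\<close>
  have "[p ^ K = 1] (mod (p - 1))"
  proof -
    have "[p = 1] (mod (p - 1))" using p_gt_1 by (simp add: cong_altdef_nat)
    then show ?thesis using cong_pow by fastforce
  qed
  then have "[b ^ p ^ K = b ^ 1] (mod p)" using b order_divides_expdiff by metis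
  then have cb: "[c ^ n = b ^ n] (mod p)" for n unfolding c_def by (intro cong_pow) simp
  have cu: "\<not> int p dvd int c ^ n - 1" if "\<not> (p - 1) dvd n" for n
  proof
    assume "int p dvd int c ^ n - 1"
    then have "[c ^ n = 1] (mod p)"
      by (metis cong_iff_dvd_diff cong_int_iff of_nat_1 of_nat_power)
    then have "[b ^ n = 1] (mod p)" using cb cong_sym cong_trans by blast
    then show False using that b by (simp only: ord_divides)
  qed
  have Nl: "\<not> (p - 1) dvd n" if "n \<in> N" for n
    using assms(1,3) that cong_dvd_iff by blast
  have "\<exists>M0. \<forall>M\<ge>M0. pd K ((of_nat c ^ n - 1) * euler_quotient n - of_int (voronoi_sum c M n))" if "n \<in> N" for n
    using voronoi cp assms(3) that by blast
  then obtain m where m: "\<And>n M. n \<in> N \<Longrightarrow> M \<ge> m n \<Longrightarrow>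
      pd K ((of_nat c ^ n - 1) * euler_quotient n - of_int (voronoi_sum c M n))"
    by metis
  \<comment> \<open>The sum bounds every \<open>m n\<close>, so that one \<open>M\<close> serves for
    all of \<open>N\<close>.\<close>
  define M where "M = sum m N"
  have M: "M \<ge> m n" if "n \<in> N" for n
    unfolding M_def using that assms(2) by (simp add: member_le_sum)
  have int: "pd 0 (euler_quotient n)" if n: "n \<in> N" for n
  proof -
    have "pd 0 ((of_nat c ^ n - 1) * euler_quotient n - of_int (voronoi_sum c M n))"
      using m[OF n M[OF n]] by (rule pd_mono) simp
    moreover have "pd 0 (of_int (voronoi_sum c M n))" by (simp add: pd_of_int)
    ultimately have "pd 0 (of_int (int c ^ n - 1) * euler_quotient n)"
      using pd_cong by fastforce
    then show ?thesis using pd_unit_mult[OF cu[OF Nl[OF n]]] by blast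
  qed
  \<comment> \<open>Since \<open>euler_quotient n\<close> is \<open>p\<close>-integral, replacing
    \<open>c ^ n\<close> by \<open>c ^ l\<close> costs only a multiple of
    \<open>p ^ K\<close>.\<close>
  have "pd K (of_int (int c ^ l - 1) * euler_quotient n - of_int (voronoi_sum c M n))" if n: "n \<in> N" for n
  proof -
    have "[int c ^ n = int c ^ l] (mod int p ^ Suc K)"
      using cc[of n] assms(3)[OF n] by (metis cong_int_iff of_nat_power)
    then have "int p ^ Suc K dvd int c ^ n - int c ^ l" by (simp add: cong_iff_dvd_diff)
    then have "pd K (of_int (int c ^ n - int c ^ l))"
      unfolding pd_of_int by (rule power_le_dvd) simp
    then have "pd (K + 0) (of_int (int c ^ n - int c ^ l) * euler_quotient n)"
      using int[OF n] by (rule pd_mult)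
    then have "pd K (((of_nat c ^ n - 1) * euler_quotient n - of_int (voronoi_sum c M n))
        - of_int (int c ^ n - int c ^ l) * euler_quotient n)"
      by (intro pd_diff[OF m[OF n M[OF n]]]) simp
    then show ?thesis by (simp add: algebra_simps)
  qed
  then show ?thesis using that cu[OF assms(1)] cp int by blast
qed

section \<open>Euler quotients along a residue class modulo \<open>p - 1\<close>: Kummer congruence
  and linearity\<close>

definition branch :: "nat \<Rightarrow> nat \<Rightarrow> rat" where
  "branch l s = euler_quotient (l + s * (p - 1))"

text \<open>The variable \<open>s\<close> enters only as an exponent of
  \<open>(c * a) ^ (p - 1)\<close>, which is 1 modulo \<open>p\<close>.\<close>

lemma voronoi_sum_branch:
  assumes "l \<ge> 1"
  shows "voronoi_sum c M (l + s * (p - 1))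
    = (\<Sum>a\<in>units M. int (c * a div p ^ M) * int (c * a) ^ (l - 1) * (int (c * a) ^ (p - 1)) ^ s)"
proof -
  have "l + s * (p - 1) - 1 = (l - 1) + (p - 1) * s"
    using assms by (simp add: mult.commute)
  then show ?thesis
    by (simp only: voronoi_sum_def power_add power_mult mult.assoc)
qed

lemma units_power_cong:
  assumes "coprime c p" "a \<in> units M"
  shows "int p dvd int (c * a) ^ (p - 1) - 1"
proof -
  have "\<not> p dvd c * a"
    using assms by (auto simp: units_def coprime_dvd_mult_right_iff coprime_commute)
  then have "\<not> int p dvd int (c * a)" by (metis int_dvd_int_iff)
  then show ?thesis by (rule fermat_int)
qed

lemma branch_integral:
  assumes "\<not> (p - 1) dvd l" "l \<ge> 1"
  shows "pd 0 (branch l s)"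
proof -
  show ?thesis
    using assms unfolding branch_def
    by (rule_tac N = "{l + s * (p - 1)}" and l = l in euler_quotient_voronoi) (auto simp: cong_def)
qed

text \<open>With common \<open>u\<close>, \<open>c\<close> and \<open>M\<close>, the Voronoi sums at
  \<open>s\<close> and 0 differ only through \<open>s\<close>-th powers of numbers that are 1 modulo
  \<open>p\<close>.\<close>

lemma branch_kummer:
  assumes "\<not> (p - 1) dvd l" "l \<ge> 1"
  shows "pd 1 (branch l s - branch l 0)"
proof -
  define N where "N = (\<lambda>s. l + s * (p - 1)) ` {s, 0}"
  obtain u c M where u: "\<not> int p dvd u" and c: "coprime c p" and
    V: "\<And>n. n \<in> N \<Longrightarrow> pd 1 (of_int u * euler_quotient n - of_int (voronoi_sum c M n))"
    by (rule euler_quotient_voronoi[of l N 1]) (use assms in \<open>auto simp: N_def cong_def\<close>)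
  define V' where "V' s = voronoi_sum c M (l + s * (p - 1))" for s
  have V': "pd 1 (of_int u * branch l i - of_int (V' i))" if "i \<in> {s, 0}" for i
    using V[of "l + i * (p - 1)"] that unfolding N_def branch_def V'_def by blast
  have "V' s - V' 0 = (\<Sum>a\<in>units M. int (c * a div p ^ M) * int (c * a) ^ (l - 1)
      * ((int (c * a) ^ (p - 1)) ^ s - 1))"
    unfolding V'_def voronoi_sum_branch[OF assms(2)] sum_subtractf[symmetric]
    by (simp only: power_0 mult_1_right right_diff_distrib)
  moreover have "int p dvd (int (c * a) ^ (p - 1)) ^ s - 1" if "a \<in> units M" for a
    by (rule dvd_trans[OF units_power_cong[OF c that]]) (simp add: power_diff_1_eq)
  ultimately have "int p dvd V' s - V' 0" by (simp only:) (intro dvd_sum dvd_mult)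
  then have "pd 1 (of_int (V' s - V' 0))" by (simp only: pd_of_int power_one_right)
  moreover have "pd 1 ((of_int u * branch l s - of_int (V' s)) - (of_int u * branch l 0 - of_int (V' 0)))"
    by (rule pd_diff[OF V' V']) simp_all
  ultimately have "pd 1 (of_int (V' s - V' 0) +
      ((of_int u * branch l s - of_int (V' s)) - (of_int u * branch l 0 - of_int (V' 0))))"
    by (rule pd_add)
  then have "pd 1 (of_int u * (branch l s - branch l 0))" by (simp add: algebra_simps)
  then show ?thesis using u pd_unit_mult by blast
qed

text \<open>To the required precision, \<open>u\<close> times the branch is an integer combination
  of powers \<open>y ^ s\<close> with \<open>y\<close> congruent to 1 modulo \<open>p\<close>. For a
  single \<open>y\<close> the error is \<open>y ^ s\<close> times that of
  \<open>power_linear_approx\<close>, plus \<open>(y ^ s - 1) * t * (y - 1)\<close>. The latter has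
  \<open>p ^ v\<close> from \<open>t\<close> and one \<open>p\<close> from each of the other
  factors.\<close>

lemma branch_linear:
  assumes "odd p" "\<not> (p - 1) dvd l" "l \<ge> 1" "p ^ v dvd t"
  shows "pd (v + 2) (branch l (s + t) - branch l s - of_nat t * (branch l 1 - branch l 0))"
proof -
  \<comment> \<open>The same \<open>u\<close>, \<open>c\<close> and \<open>M\<close> must serve for
    all four arguments.\<close>
  define I where "I = {s + t, s, 1, 0}"
  define N where "N = (\<lambda>s. l + s * (p - 1)) ` I"
  obtain u c M where u: "\<not> int p dvd u" and c: "coprime c p" and
    V: "\<And>n. n \<in> N \<Longrightarrow> pd (v + 2) (of_int u * euler_quotient n - of_int (voronoi_sum c M n))"
    by (rule euler_quotient_voronoi[of l N "v + 2"])
      (use assms in \<open>auto simp: N_def I_def cong_def\<close>)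
  define V' where "V' s = voronoi_sum c M (l + s * (p - 1))" for s
  define e where "e i = of_int u * branch l i - of_int (V' i)" for i
  have e: "pd (v + 2) (e i)" if "i \<in> I" for i
    using V[of "l + i * (p - 1)"] that unfolding N_def branch_def V'_def e_def by blast
  define y where "y a = int (c * a) ^ (p - 1)" for a
  have "V' (s + t) - V' s - int t * (V' 1 - V' 0)
      = (\<Sum>a\<in>units M. int (c * a div p ^ M) * int (c * a) ^ (l - 1)
          * (y a ^ (s + t) - y a ^ s - int t * (y a - 1)))"
    unfolding V'_def voronoi_sum_branch[OF assms(3)] sum_subtractf[symmetric] sum_distrib_left y_def
    by (rule sum.cong) (simp_all add: right_diff_distrib mult_ac)
  moreover have "int p ^ (v + 2) dvd y a ^ (s + t) - y a ^ s - int t * (y a - 1)" if "a \<in> units M" for a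
  proof -
    have y: "int p dvd y a - 1" using units_power_cong[OF c that] by (simp only: y_def)
    have "int p ^ (v + 2) dvd y a ^ s * (y a ^ t - 1 - int t * (y a - 1))"
      using power_linear_approx[OF assms(1) y assms(4)] by (rule dvd_mult)
    moreover have "int p ^ (v + 2) dvd (y a ^ s - 1) * (int t * (y a - 1))"
    proof -
      have "int p dvd y a ^ s - 1" by (rule dvd_trans[OF y]) (simp add: power_diff_1_eq)
      moreover have "int p ^ v dvd int t" using assms(4) by (simp flip: of_nat_power)
      ultimately have "int p * (int p ^ v * int p) dvd (y a ^ s - 1) * (int t * (y a - 1))"
        using y by (intro mult_dvd_mono)
      then show ?thesis by (simp add: mult_ac)
    qed
    ultimately have "int p ^ (v + 2) dvd y a ^ s * (y a ^ t - 1 - int t * (y a - 1))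
        + (y a ^ s - 1) * (int t * (y a - 1))" by (rule dvd_add)
    also have "\<dots> = y a ^ (s + t) - y a ^ s - int t * (y a - 1)"
      by (simp add: power_add algebra_simps)
    finally show ?thesis .
  qed
  ultimately have "int p ^ (v + 2) dvd V' (s + t) - V' s - int t * (V' 1 - V' 0)"
    by (simp only:) (intro dvd_sum dvd_mult)
  then have "pd (v + 2) (of_int (V' (s + t) - V' s - int t * (V' 1 - V' 0)))"
    by (simp only: pd_of_int)
  moreover have "pd (v + 2) (e (s + t) - e s - of_nat t * (e 1 - e 0))"
    using e by (intro pd_diff pd_nat_mult) (auto simp: I_def)
  ultimately have "pd (v + 2) (of_int (V' (s + t) - V' s - int t * (V' 1 - V' 0))
      + (e (s + t) - e s - of_nat t * (e 1 - e 0)))" by (rule pd_add)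
  also have "of_int (V' (s + t) - V' s - int t * (V' 1 - V' 0))
      + (e (s + t) - e s - of_nat t * (e 1 - e 0))
      = of_int u * (branch l (s + t) - branch l s - of_nat t * (branch l 1 - branch l 0))"
    by (simp add: e_def algebra_simps)
  finally show ?thesis using u pd_unit_mult by blast
qed

end

subsection \<open>Irregular pairs\<close>

context rat_adic
begin

text \<open>For \<open>n \<ge> 2\<close> the Euler factor \<open>1 - p ^ (n - 1)\<close> is a
  \<open>p\<close>-adic unit.\<close>

lemma pd_euler_quotient_iff:
  assumes "n \<ge> 2"
  shows "pd k (euler_quotient n) \<longleftrightarrow> pd k (bernoulli n / of_nat n)"
proof -
  have "int p dvd int p ^ (n - 1)" using assms by simp
  moreover have "\<not> int p dvd 1" using prime_int not_prime_unit by blast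
  ultimately have "\<not> int p dvd 1 - int p ^ (n - 1)"
    by (metis dvd_add diff_add_cancel)
  from pd_unit_mult[OF this, of k "bernoulli n / of_nat n"] show ?thesis
    by (simp add: euler_quotient_def)
qed

end

locale irregular_pair = rat_adic +
  fixes l :: nat
  assumes irr: "(p, l) \<in> Psi_irr 1"
begin

lemma odd_p: "odd p" and l_ge_2: "l \<ge> 2" and l_less: "l < p - 1" and even_l: "even l"
  and pd_l: "pd 1 (bernoulli l / of_nat l)"
  using irr prime_p by (auto simp: Psi_irr_def totient_prime)

lemma not_dvd_l: "\<not> (p - 1) dvd l"
  using l_ge_2 l_less nat_dvd_not_less by auto

lemma l_le: "l \<le> p - 3"
proof -
  have "even (p - 1)" using odd_p by simp
  then have "l \<noteq> p - 2" using even_l l_less by (auto simp: even_diff_nat odd_p)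
  then show ?thesis using l_less by simp
qed

definition slope :: rat where
  "slope = branch l 1 - branch l 0"

lemma pd_branch_iff:
  "pd k (branch l s) \<longleftrightarrow> pd k (bernoulli (l + s * (p - 1)) / of_nat (l + s * (p - 1)))"
  unfolding branch_def using l_ge_2 by (intro pd_euler_quotient_iff) simp

lemma pd_branch: "pd 1 (branch l s)"
proof -
  have "pd 1 (branch l 0)" using pd_l pd_branch_iff[of 1 0] by simp
  then show ?thesis using pd_cong branch_kummer[OF not_dvd_l] l_ge_2 by fastforce
qed

lemma pd_slope: "pd 1 slope"
  unfolding slope_def by (rule pd_diff[OF pd_branch pd_branch])

lemma branch_slope:
  assumes "p ^ v dvd t"
  shows "pd (v + 2) (branch l (s + t) - branch l s - of_nat t * slope)"
  unfolding slope_def using branch_linear[OF odd_p not_dvd_l _ assms] l_ge_2 by simp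

text \<open>Dropping the Euler factor changes a branch value only by a multiple of
  \<open>p ^ 2\<close>, because \<open>p\<close> divides both \<open>p ^ (n - 1)\<close> and the
  Bernoulli quotient. Hence \<open>slope / p\<close> is congruent to \<Delta> modulo
  \<open>p\<close>.\<close>

lemma irr_Delta_eq_0_iff: "irr_Delta 1 p l = 0 \<longleftrightarrow> pd 2 slope"
proof -
  define b where "b n = bernoulli n / of_nat n" for n
  have q: "pd 2 (branch l s - b (l + s * (p - 1)))" for s
  proof -
    let ?n = "l + s * (p - 1)"
    have "pd 1 (b ?n)" unfolding b_def using pd_branch pd_branch_iff by blast
    moreover have "pd 1 (of_nat (p ^ (?n - 1)))" using l_ge_2 by (subst pd_of_nat) simp
    ultimately have "pd (1 + 1) (of_nat (p ^ (?n - 1)) * b ?n)" by (rule pd_mult[rotated])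
    moreover have "branch l s - b ?n = - (of_nat (p ^ (?n - 1)) * b ?n)"
      unfolding branch_def euler_quotient_def b_def
      by (simp only: left_diff_distrib diff_divide_distrib times_divide_eq_right[symmetric]) simp
    ultimately show ?thesis by (simp add: numeral_2_eq_2)
  qed
  define y where "y = (b (l + totient (p ^ 1)) - b l) / of_nat p ^ 1"
  have py: "of_nat p ^ 1 * y = b (l + (p - 1)) - b l"
    using p_pos prime_p by (simp add: y_def totient_prime)
  have eq: "pd 2 (slope - of_nat p ^ 1 * y)"
    using pd_diff[OF q[of 1] q[of 0]] unfolding py slope_def by (simp add: algebra_simps)
  then have "pd 1 (of_nat p ^ 1 * y)"
    using pd_cong[of 1] pd_mono[of 2 _ 1] pd_slope by (metis one_le_numeral)
  then have "pd 0 y" using pd_power_cancel[of 1 0 y] by simp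
  then obtain d where d: "d < p" "pd 1 (of_nat d - y)" by (rule pd_residue)
  have "irr_Delta 1 p l = d"
    unfolding irr_Delta_def b_def[symmetric] y_def[symmetric]
    using d pd_residue_unique by (intro the_equality) blast+
  moreover have "d = 0 \<longleftrightarrow> pd 1 y"
  proof
    assume "pd 1 y"
    then have "pd 1 (of_nat 0 - y)" by simp
    then show "d = 0" using d p_pos pd_residue_unique by blast
  qed (use d in auto)
  moreover have "pd 1 y \<longleftrightarrow> pd 2 slope"
    using pd_power_cancel[of 1 1 y] pd_cong[OF eq] by (simp add: numeral_2_eq_2)
  ultimately show ?thesis by simp
qed

section \<open>Tuples and base \<open>p\<close> digits\<close>

definition digit_sum :: "(nat \<Rightarrow> nat) \<Rightarrow> nat \<Rightarrow> nat" where
  "digit_sum s k = (\<Sum>\<nu><k. s (\<nu> + 1) * p ^ \<nu>)"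

lemma digit_sum_less:
  assumes "\<And>i. 1 \<le> i \<Longrightarrow> i \<le> k \<Longrightarrow> s i < p"
  shows "digit_sum s k < p ^ k"
  using assms
proof (induction k)
  case (Suc k)
  have "s (k + 1) + 1 \<le> p" using Suc.prems[of "k + 1"] by simp
  then have "(s (k + 1) + 1) * p ^ k \<le> p * p ^ k" by (rule mult_right_mono) simp
  then show ?case using Suc by (simp add: digit_sum_def)
qed (simp add: digit_sum_def)

text \<open>As \<open>totient (p ^ Suc i) = p ^ i * (p - 1)\<close>, the tuple encodes
  \<open>l + digit_sum s k * (p - 1)\<close>: its first entry fixes the branch and the others are
  digits of the argument. Size and parity follow from the digit bounds, which leaves the
  divisibility condition.\<close>

lemma Psi_irr_hat_iff:
  assumes "s 0 = l"
  shows "(p, map s [0..<Suc k]) \<in> Psi_irr_hat (Suc k)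
    \<longleftrightarrow> (\<forall>i. 1 \<le> i \<and> i \<le> k \<longrightarrow> s i < p) \<and> pd (Suc k) (branch l (digit_sum s k))"
proof -
  have nth: "map s [0..<Suc k] ! (\<nu> - 1) = s (\<nu> - 1)" if "\<nu> \<in> {1..Suc k}" for \<nu>
    using that by (subst nth_map) (auto simp del: upt_Suc)
  have "(\<Sum>\<nu>=1..Suc k. map s [0..<Suc k] ! (\<nu> - 1) * totient (p ^ (\<nu> - 1)))
      = (\<Sum>\<nu>=1..Suc k. s (\<nu> - 1) * totient (p ^ (\<nu> - 1)))"
    using nth by (intro sum.cong) simp_all
  also have "\<dots> = (\<Sum>i<Suc k. s i * totient (p ^ i))"
    by (rule sum.reindex_bij_witness[of _ Suc "\<lambda>\<nu>. \<nu> - 1"]) auto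
  also have "\<dots> = l + (\<Sum>i<k. s (i + 1) * totient (p ^ Suc i))"
    unfolding sum.lessThan_Suc_shift by (simp add: assms)
  also have "\<dots> = l + digit_sum s k * (p - 1)"
    unfolding totient_prime_power_Suc[OF prime_p]
    by (simp add: digit_sum_def sum_distrib_left mult_ac)
  finally have sum: "(\<Sum>\<nu>=1..Suc k. map s [0..<Suc k] ! (\<nu> - 1) * totient (p ^ (\<nu> - 1)))
      = l + digit_sum s k * (p - 1)" .
  have bound: "(\<forall>\<nu>\<in>{1..Suc k}. map s [0..<Suc k] ! (\<nu> - 1) < p) \<longleftrightarrow> (\<forall>i. 1 \<le> i \<and> i \<le> k \<longrightarrow> s i < p)"
  proof -
    have "(\<forall>\<nu>\<in>{1..Suc k}. map s [0..<Suc k] ! (\<nu> - 1) < p) \<longleftrightarrow> (\<forall>\<nu>\<in>{1..Suc k}. s (\<nu> - 1) < p)"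
      using nth by (intro ball_cong) simp_all
    also have "\<dots> \<longleftrightarrow> (\<forall>\<nu>\<in>Suc ` {..k}. s (\<nu> - 1) < p)" by (simp only: image_Suc_atMost)
    also have "(\<forall>\<nu>\<in>Suc ` {..k}. s (\<nu> - 1) < p) \<longleftrightarrow> (\<forall>i\<le>k. s i < p)" by auto
    also have "\<dots> \<longleftrightarrow> (\<forall>i. 1 \<le> i \<and> i \<le> k \<longrightarrow> s i < p)"
    proof -
      have "s 0 < p" using assms l_less by simp
      then show ?thesis by (metis less_one linorder_not_le)
    qed
    finally show ?thesis .
  qed
  have s0: "map s [0..<Suc k] ! 0 = l" using nth[of 1] assms by simp
  have less: "l + digit_sum s k * (p - 1) < totient (p ^ Suc k)" if "\<And>i. 1 \<le> i \<Longrightarrow> i \<le> k \<Longrightarrow> s i < p"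
  proof -
    have "digit_sum s k + 1 \<le> p ^ k" using digit_sum_less[of k s] that by simp
    then have "(digit_sum s k + 1) * (p - 1) \<le> p ^ k * (p - 1)" by (rule mult_right_mono) simp
    then show ?thesis using l_less unfolding totient_prime_power_Suc[OF prime_p] by simp
  qed
  have ev: "even (l + digit_sum s k * (p - 1))" using even_l odd_p by simp
  have "(p, map s [0..<Suc k]) \<in> Psi_irr_hat (Suc k) \<longleftrightarrow>
      (\<forall>i. 1 \<le> i \<and> i \<le> k \<longrightarrow> s i < p) \<and> (p, l + digit_sum s k * (p - 1)) \<in> Psi_irr (Suc k)"
    unfolding Psi_irr_hat_def mem_Collect_eq prod.case sum bound s0
    using even_l l_ge_2 l_le by (simp del: upt_Suc)
  also have "\<dots> \<longleftrightarrow> (\<forall>i. 1 \<le> i \<and> i \<le> k \<longrightarrow> s i < p) \<and> pd (Suc k) (branch l (digit_sum s k))"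
    using less ev prime_p odd_p l_ge_2 unfolding pd_branch_iff Psi_irr_def by auto
  finally show ?thesis .
qed

end

section \<open>Nonzero \<Delta>: the unique zero of the branch\<close>

locale irregular_pair_simple = irregular_pair +
  assumes slope_unit: "\<not> pd 2 slope"
begin

lemma slope_factor:
  obtains e where "pd 0 e" "\<not> pd 1 e" "slope = of_nat p ^ 1 * e"
proof -
  obtain e where e: "pd 0 e" "slope = of_nat p ^ 1 * e" using pd_slope by (rule pd_obtain_factor)
  then have "\<not> pd 1 e" using slope_unit pd_power_cancel[of 1 1 e] by (simp add: numeral_2_eq_2)
  then show ?thesis using that e by blast
qed

lemma pd_slope_mult_dvd:
  assumes "pd 2 (of_nat t * slope)"
  shows "p dvd t"
proof -
  obtain e where e: "pd 0 e" "\<not> pd 1 e" "slope = of_nat p ^ 1 * e" by (rule slope_factor)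
  have "pd (1 + 1) (of_nat p ^ 1 * (of_nat t * e))"
    using assms e(3) by (simp add: mult_ac numeral_2_eq_2)
  then have "pd 1 (of_nat t * e)" using pd_power_cancel by blast
  then have "pd 1 (of_nat t) \<or> pd 1 e" using e(1) by (intro pd_prime) (simp_all add: pd_of_nat)
  then show ?thesis using e(2) by (simp add: pd_of_nat)
qed

text \<open>The slope has order exactly 1; the induction peels off one factor \<open>p\<close> of
  \<open>t\<close> at a time.\<close>

lemma pd_slope_mult: "pd (v + 2) (of_nat t * slope) \<longleftrightarrow> p ^ (v + 1) dvd t"
proof
  assume "p ^ (v + 1) dvd t"
  then have "pd (v + 1) (of_nat t)" by (simp only: pd_of_nat)
  from pd_mult[OF this pd_slope] show "pd (v + 2) (of_nat t * slope)" by simp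
next
  assume "pd (v + 2) (of_nat t * slope)"
  then show "p ^ (v + 1) dvd t"
  proof (induction v)
    case 0
    then show ?case using pd_slope_mult_dvd by (simp add: numeral_2_eq_2)
  next
    case (Suc v)
    then have "p ^ (v + 1) dvd t" using pd_mono by fastforce
    then obtain t' where t': "t = p ^ (v + 1) * t'" by blast
    then have "pd ((v + 1) + 2) (of_nat p ^ (v + 1) * (of_nat t' * slope))"
      using Suc.prems by (simp add: mult_ac)
    then have "pd 2 (of_nat t' * slope)" using pd_power_cancel by blast
    then have "p dvd t'" by (rule pd_slope_mult_dvd)
    then show ?case by (simp add: t')
  qed
qed

text \<open>The branch scales \<open>p\<close>-adic distances by exactly one factor
  \<open>p\<close>. In the induction step either side yields \<open>p ^ v dvd t\<close>; then the
  linear term decides modulo \<open>p ^ (v + 2)\<close>.\<close>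

lemma branch_diff_iff: "pd (v + 1) (branch l (s + t) - branch l s) \<longleftrightarrow> p ^ v dvd t"
proof (induction v)
  case 0
  show ?case using pd_diff[OF pd_branch pd_branch] by simp
next
  case (Suc v)
  have "pd (Suc v + 1) (branch l (s + t) - branch l s) \<longleftrightarrow> p ^ Suc v dvd t" if "p ^ v dvd t"
  proof -
    have "pd (v + 2) (branch l (s + t) - branch l s) \<longleftrightarrow> pd (v + 2) (of_nat t * slope)"
      by (rule pd_cong) (rule branch_slope[OF that])
    then show ?thesis using pd_slope_mult[of v t] by simp
  qed
  moreover have "p ^ v dvd t" if "pd (Suc v + 1) (branch l (s + t) - branch l s)"
    using that Suc.IH pd_mono by fastforce
  moreover have "p ^ v dvd t" if "p ^ Suc v dvd t"
    using that by (metis dvd_mult_right power_Suc)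
  ultimately show ?case by blast
qed

lemma branch_diff_iff_int: "pd (v + 1) (branch l s - branch l t) \<longleftrightarrow> int p ^ v dvd int s - int t"
proof -
  have *: "pd (v + 1) (branch l s - branch l t) \<longleftrightarrow> int p ^ v dvd int s - int t" if "t \<le> s" for s t
  proof -
    have "p ^ v dvd s - t \<longleftrightarrow> int p ^ v dvd int s - int t"
      using that by (metis int_dvd_int_iff of_nat_diff of_nat_power)
    then show ?thesis using branch_diff_iff[of v t "s - t"] that by simp
  qed
  show ?thesis
  proof (cases "t \<le> s")
    case False
    have "branch l s - branch l t = - (branch l t - branch l s)" by simp
    then have "pd (v + 1) (branch l s - branch l t) \<longleftrightarrow> pd (v + 1) (branch l t - branch l s)"
      by (simp only: pd_minus)
    also have "\<dots> \<longleftrightarrow> int p ^ v dvd int t - int s" using False by (intro *) simp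
    finally show ?thesis by (simp only: dvd_diff_commute)
  qed (rule *)
qed

lemma branch_root_unique:
  assumes "x < p ^ k" "y < p ^ k" "pd (k + 1) (branch l x)" "pd (k + 1) (branch l y)"
  shows "x = y"
proof -
  have "int p ^ k dvd int x - int y"
    using pd_diff[OF assms(3,4)] by (simp only: branch_diff_iff_int)
  then have "[x = y] (mod p ^ k)" by (metis cong_iff_dvd_diff cong_int_iff of_nat_power)
  then show ?thesis using assms(1,2) by (rule cong_less_modulus_unique_nat)
qed

text \<open>Hensel lifting: passing from \<open>x\<close> to \<open>x + j * p ^ k\<close> changes
  the value by \<open>j * p ^ (k + 1) * e\<close> modulo \<open>p ^ (k + 2)\<close>, where the unit
  \<open>e\<close> is \<open>slope / p\<close>.\<close>

lemma branch_root_exists: "\<exists>x<p ^ k. pd (k + 1) (branch l x)"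
proof (induction k)
  case 0
  show ?case using pd_branch[of 0] by (intro exI[of _ 0]) simp
next
  case (Suc k)
  then obtain x where x: "x < p ^ k" "pd (k + 1) (branch l x)" by blast
  obtain e where e: "pd 0 e" "\<not> pd 1 e" "slope = of_nat p ^ 1 * e" by (rule slope_factor)
  obtain y where y: "pd 0 y" "branch l x = of_nat p ^ (k + 1) * y" using x(2) by (rule pd_obtain_factor)
  obtain e' where e': "e' < p" "pd 1 (of_nat e' - e)" using e(1) by (rule pd_residue)
  obtain y' where y': "y' < p" "pd 1 (of_nat y' - y)" using y(1) by (rule pd_residue)
  have "\<not> pd 1 (of_nat e')" using pd_cong[OF e'(2)] e(2) by blast
  then have "coprime (int e') (int p)" using not_dvd_iff_coprime by (simp add: pd_of_nat)
  then obtain c where c: "[int e' * c = 1] (mod int p)" using cong_solve_coprime_int by blast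
  \<comment> \<open>\<open>j\<close> solves \<open>y + j * e = 0\<close> modulo \<open>p\<close>;
    \<open>c\<close> is the inverse of \<open>e\<close>.\<close>
  define j where "j = nat ((- int y' * c) mod int p)"
  have j: "int j = (- int y' * c) mod int p" "j < p" using p_pos by (auto simp: j_def nat_less_iff)
  have "[int y' + int j * int e' = int y' + (- int y' * c) * int e'] (mod int p)"
    unfolding j by (intro cong_add cong_mult) (simp_all add: cong_def)
  also have "int y' + (- int y' * c) * int e' = int y' - int y' * (int e' * c)" by simp
  also have "[\<dots> = int y' - int y' * 1] (mod int p)"
    using c by (intro cong_diff cong_mult) auto
  finally have "int p dvd int y' + int j * int e'" by (simp add: cong_0_iff)
  then have "pd 1 (of_int (int y' + int j * int e'))" by (simp only: pd_of_int power_one_right)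
  moreover have "pd 1 ((of_nat y' - y) + of_nat j * (of_nat e' - e))"
    by (intro pd_add y' pd_nat_mult e')
  ultimately have "pd 1 (of_int (int y' + int j * int e') - ((of_nat y' - y) + of_nat j * (of_nat e' - e)))"
    by (rule pd_diff)
  then have "pd 1 (y + of_nat j * e)" by (simp add: algebra_simps)
  then have "pd ((k + 1) + 1) (of_nat p ^ (k + 1) * (y + of_nat j * e))"
    using pd_power_cancel by blast
  also have "of_nat p ^ (k + 1) * (y + of_nat j * e) = branch l x + of_nat (j * p ^ k) * slope"
    unfolding y(2) e(3) by (simp add: algebra_simps)
  finally have "pd (k + 2) (branch l x + of_nat (j * p ^ k) * slope)" by simp
  moreover have "pd (k + 2) (branch l (x + j * p ^ k) - branch l x - of_nat (j * p ^ k) * slope)"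
    by (rule branch_slope) simp
  ultimately have "pd (k + 2) (branch l (x + j * p ^ k))"
    using pd_cong[of "k + 2" "branch l (x + j * p ^ k)" "branch l x + of_nat (j * p ^ k) * slope"]
    by (simp add: diff_diff_eq)
  moreover have "x + j * p ^ k < p ^ Suc k"
  proof -
    have "(j + 1) * p ^ k \<le> p * p ^ k" using j(2) by (intro mult_right_mono) auto
    then show ?thesis using x(1) by simp
  qed
  ultimately show ?case by auto
qed

text \<open>The truncation of the zero \<chi> modulo \<open>p ^ k\<close>. The precision is
  \<open>k + 1\<close> because all values of the branch are divisible by \<open>p\<close>.\<close>

definition root :: "nat \<Rightarrow> nat" where
  "root k = (THE x. x < p ^ k \<and> pd (k + 1) (branch l x))"

lemma root: "root k < p ^ k" "pd (k + 1) (branch l (root k))"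
proof -
  have "\<exists>!x. x < p ^ k \<and> pd (k + 1) (branch l x)"
    using branch_root_exists branch_root_unique by blast
  from theI'[OF this] show "root k < p ^ k" "pd (k + 1) (branch l (root k))"
    unfolding root_def by auto
qed

lemma root_eqI: "x < p ^ k \<Longrightarrow> pd (k + 1) (branch l x) \<Longrightarrow> x = root k"
  using branch_root_unique root by blast

lemma root_Suc_mod: "root (Suc k) mod p ^ k = root k"
proof (rule root_eqI)
  have "[root (Suc k) mod p ^ k = root (Suc k)] (mod p ^ k)" by (simp add: cong_def)
  then have "[int (root (Suc k) mod p ^ k) = int (root (Suc k))] (mod int (p ^ k))"
    by (simp only: cong_int_iff)
  then have "pd (k + 1) (branch l (root (Suc k) mod p ^ k) - branch l (root (Suc k)))"
    unfolding branch_diff_iff_int by (simp only: cong_iff_dvd_diff of_nat_power)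
  then show "pd (k + 1) (branch l (root (Suc k) mod p ^ k))"
    using pd_cong pd_mono[OF root(2)[of "Suc k"], of "k + 1"] by simp
qed (use p_pos in simp)

text \<open>The digit sums of any admissible sequence are forced to be \<open>root k\<close>, which
  determines its digits; conversely the digits of the compatible residues \<open>root k\<close> are
  admissible. So the definite description is meaningful.\<close>

lemma irr_seq: "irr_seq p l 0 = l" "digit_sum (irr_seq p l) k = root k"
proof -
  define Q where "Q s \<longleftrightarrow> s 0 = l \<and> (\<forall>n\<ge>1. (p, map s [0..<n]) \<in> Psi_irr_hat n)" for s
  have Q: "Q s \<longleftrightarrow> s 0 = l \<and> (\<forall>i\<ge>1. s i < p) \<and> (\<forall>k. pd (k + 1) (branch l (digit_sum s k)))" for s
  proof -
    have "(\<forall>n\<ge>1. (p, map s [0..<n]) \<in> Psi_irr_hat n) \<longleftrightarrow> (\<forall>k. (p, map s [0..<Suc k]) \<in> Psi_irr_hat (Suc k))"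
      by (metis One_nat_def Suc_le_D le_add1 plus_1_eq_Suc)
    then show ?thesis unfolding Q_def using Psi_irr_hat_iff by auto
  qed
  have ds: "digit_sum s k = root k" if "Q s" for s k
    using that unfolding Q by (intro root_eqI digit_sum_less) auto
  \<comment> \<open>The entry at \<open>Suc k\<close> is the leading digit of
    \<open>root (Suc k)\<close>, whose lower part is \<open>root k\<close>.\<close>
  define s where "s i = (case i of 0 \<Rightarrow> l | Suc k \<Rightarrow> root (Suc k) div p ^ k)" for i
  have ss: "digit_sum s k = root k" for k
  proof (induction k)
    case 0
    then show ?case using root(1)[of 0] by (simp add: digit_sum_def)
  next
    case (Suc k)
    then have "digit_sum s (Suc k) = root (Suc k) mod p ^ k + root (Suc k) div p ^ k * p ^ k"
      by (simp add: digit_sum_def s_def root_Suc_mod)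
    then show ?case by (simp only: mod_div_mult_eq)
  qed
  have "s i < p" if "i \<ge> 1" for i
  proof -
    obtain k where "i = Suc k" using \<open>i \<ge> 1\<close> by (cases i) auto
    then show ?thesis using root(1)[of "Suc k"] by (simp add: s_def less_mult_imp_div_less)
  qed
  then have Qs: "Q s" unfolding Q ss using root by (simp add: s_def)
  have unique: "s' = s" if "Q s'" for s'
  proof
    fix i
    show "s' i = s i"
    proof (cases i)
      case 0
      then show ?thesis using that Qs unfolding Q_def by simp
    next
      case (Suc k)
      have "digit_sum s' (Suc k) - digit_sum s' k = digit_sum s (Suc k) - digit_sum s k"
        using ds[OF that] ds[OF Qs] by simp
      then show ?thesis using p_pos Suc by (simp add: digit_sum_def)
    qed
  qed
  have "irr_seq p l = s"
    unfolding irr_seq_def Q_def[symmetric] using Qs unique by (rule the_equality)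
  then show "irr_seq p l 0 = l" "digit_sum (irr_seq p l) k = root k"
    using ss by (auto simp: s_def)
qed

lemma irr_chi: "irr_chi p l k = int (root k)"
proof -
  have "(\<Sum>\<nu><k. int (irr_seq p l (\<nu> + 1)) * int p ^ \<nu>) = int (root k)"
    by (simp flip: irr_seq(2) add: digit_sum_def)
  then show ?thesis using root(1)[of k] by (simp add: irr_chi_def Zp_series_def flip: of_nat_power)
qed

section \<open>The factor of the product formula computed in \<open>Zp p\<close>\<close>

lemma Zp_minus:
  assumes "x \<in> carrier (Zp p)"
  shows "\<ominus>\<^bsub>Zp p\<^esub> x = (\<lambda>k. (- x k) mod int p ^ k)"
proof -
  interpret cring "Zp p" using p_pos by (rule Zp_cring)
  have "(\<lambda>k. (- x k) mod int p ^ k) \<in> carrier (Zp p)"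
  proof -
    have "(- x (Suc k)) mod int p ^ k = (- x k) mod int p ^ k" for k
    proof -
      have "x (Suc k) mod int p ^ k = x k" using assms by (auto simp: Zp_def)
      then show ?thesis by (metis mod_minus_eq)
    qed
    then show ?thesis using p_pos by (simp add: Zp_def mod_pow_Suc del: power_Suc)
  qed
  then show ?thesis using assms
    by (intro minus_equality) (simp_all, simp add: Zp_def mod_simps)
qed

text \<open>Multiplication by \<open>p\<close> shifts the precision by one, exactly as in
  \<open>branch_diff_iff\<close>. Since the branch at \<open>root k\<close> vanishes modulo
  \<open>p ^ k\<close>, its difference to the value at \<open>m\<close> may be replaced by that
  value.\<close>

lemma Zp_chi_eq_0_iff:
  "(Zp_of_int p (int p) \<otimes>\<^bsub>Zp p\<^esub> (irr_chi p l \<ominus>\<^bsub>Zp p\<^esub> Zp_of_int p (int m))) k = 0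
    \<longleftrightarrow> pd k (branch l m)"
proof -
  have "(Zp_of_int p (int p) \<otimes>\<^bsub>Zp p\<^esub> (irr_chi p l \<ominus>\<^bsub>Zp p\<^esub> Zp_of_int p (int m))) k
      = (int p * (int (root k) - int m)) mod int p ^ k"
    unfolding a_minus_def Zp_minus[OF Zp_of_int_carrier[OF p_pos]]
    by (simp add: Zp_def Zp_of_int_def irr_chi mod_simps)
  then have *: "(Zp_of_int p (int p) \<otimes>\<^bsub>Zp p\<^esub> (irr_chi p l \<ominus>\<^bsub>Zp p\<^esub> Zp_of_int p (int m))) k = 0
      \<longleftrightarrow> int p ^ k dvd int p * (int (root k) - int m)" by (simp add: dvd_eq_mod_eq_0)
  show ?thesis
  proof (cases k)
    case 0
    then show ?thesis unfolding * using pd_mono[OF pd_branch] by simp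
  next
    case (Suc j)
    have "int p ^ k dvd int p * (int (root k) - int m) \<longleftrightarrow> int p ^ j dvd int (root k) - int m"
      using p_pos Suc by simp
    also have "\<dots> \<longleftrightarrow> pd k (branch l (root k) - branch l m)"
      unfolding Suc using branch_diff_iff_int by simp
    also have "\<dots> \<longleftrightarrow> pd k (branch l m)"
    proof -
      have "pd k (branch l (root k))" using root(2) by (rule pd_mono) simp
      then show ?thesis
        using pd_diff[of k "branch l (root k)" "branch l m"]
          pd_diff[of k "branch l (root k)" "branch l (root k) - branch l m"] by auto
    qed
    finally show ?thesis unfolding * .
  qed
qed

text \<open>Both orders are the greatest \<open>k\<close> subject to equivalent conditions. As
  \<open>bernoulli n \<noteq> 0\<close>, these fail for large \<open>k\<close>, which rules out the
  value 0 of \<open>Zp_abs\<close>.\<close>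

lemma Zp_abs_chi:
  assumes "n = l + m * (p - 1)" "bernoulli n \<noteq> 0"
  shows "inverse (Zp_abs p (Zp_of_int p (int p) \<otimes>\<^bsub>Zp p\<^esub> (irr_chi p l \<ominus>\<^bsub>Zp p\<^esub> Zp_of_int p (int m))))
    = of_nat p powi rat_ord p (bernoulli n / of_nat n)"
proof -
  define y where "y = Zp_of_int p (int p) \<otimes>\<^bsub>Zp p\<^esub> (irr_chi p l \<ominus>\<^bsub>Zp p\<^esub> Zp_of_int p (int m))"
  have y: "y k = 0 \<longleftrightarrow> pd k (bernoulli n / of_nat n)" for k
    unfolding y_def Zp_chi_eq_0_iff pd_branch_iff assms(1) ..
  have nz: "bernoulli n / of_nat n \<noteq> 0"
    using assms(2) l_ge_2 unfolding assms(1) by (simp del: of_nat_add)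
  have ord: "int (Zp_ord y) = rat_ord p (bernoulli n / of_nat n)"
    unfolding Zp_ord_def y using nz
  proof (rule rat_ord_GREATEST)
    show "pd 0 (bernoulli n / of_nat n)"
      unfolding assms(1) using pd_branch pd_branch_iff pd_mono[of 1 _ 0] by blast
  qed
  have "y \<noteq> \<zero>\<^bsub>Zp p\<^esub>"
  proof
    assume "y = \<zero>\<^bsub>Zp p\<^esub>"
    then have "y k = 0" for k by (simp add: Zp_def)
    then have "pd (Suc (Zp_ord y)) (bernoulli n / of_nat n)" using y by blast
    then show False using nz ord by (simp add: pow_dvd_rat_def)
  qed
  then show ?thesis
    unfolding y_def[symmetric] ord[symmetric] by (simp add: Zp_abs_def inverse_eq_divide)
qed

end

section \<open>Vanishing \<Delta>: periodicity and the tree\<close>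

locale irregular_pair_singular = irregular_pair +
  assumes slope_0: "pd 2 slope"
begin

text \<open>The linear term has \<open>p ^ 2\<close> from the slope and \<open>p ^ r\<close> from
  \<open>t\<close>, so it disappears at the precision of \<open>branch_slope\<close>.\<close>

lemma branch_periodic:
  assumes "p ^ r dvd t"
  shows "pd (r + 2) (branch l (s + t) - branch l s)"
proof -
  have "pd r (of_nat t)" using assms by (simp only: pd_of_nat)
  then have "pd (r + 2) (of_nat t * slope)" using slope_0 by (rule pd_mult)
  then show ?thesis using pd_cong[OF branch_slope[OF assms, of s]] by blast
qed

text \<open>Since \<open>totient (p ^ Suc r) = (p - 1) * p ^ r\<close> and \<open>l < p - 1\<close>,
  the reduction acts on \<open>m\<close> alone.\<close>

lemma residue_totient: "(l + m * (p - 1)) mod totient (p ^ Suc r) = l + (m mod p ^ r) * (p - 1)"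
proof -
  have "(l + m * (p - 1)) mod totient (p ^ Suc r) = (l + m * (p - 1)) mod ((p - 1) * p ^ r)"
    by (simp only: totient_prime_power_Suc[OF prime_p] mult.commute)
  also have "\<dots> = l + (m mod p ^ r) * (p - 1)"
    unfolding mod_mult2_eq using l_less by simp
  finally show ?thesis .
qed

lemma pd_residue_iff:
  assumes "n = l + m * (p - 1)"
  shows "pd (r + 2) (bernoulli (n mod totient (p ^ Suc r)) / of_nat (n mod totient (p ^ Suc r)))
    \<longleftrightarrow> pd (r + 2) (bernoulli n / of_nat n)"
proof -
  have "m = m mod p ^ r + p ^ r * (m div p ^ r)" by simp
  then have "pd (r + 2) (branch l m - branch l (m mod p ^ r))"
    using branch_periodic[of r "p ^ r * (m div p ^ r)" "m mod p ^ r"] by simp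
  then show ?thesis
    unfolding assms residue_totient pd_branch_iff[symmetric] using pd_cong by blast
qed

lemma irr_tree_less: "(r, l') \<in> irr_tree p l \<Longrightarrow> l' < totient (p ^ Suc r)"
proof (induction rule: irr_tree.induct)
  case root
  then show ?case using l_less prime_p by (simp add: totient_prime)
next
  case (child r l' j)
  have "(j + 1) * totient (p ^ Suc r) \<le> p * totient (p ^ Suc r)"
    using child by (intro mult_right_mono) auto
  then show ?case using child(4) by (simp add: totient_prime_power_Suc[OF prime_p] del: power_Suc) simp
qed

text \<open>Induction along the path of residues of \<open>n\<close>. A node of height
  \<open>r\<close> on it has children iff its label lies in \<open>Psi_irr (r + 2)\<close>, which by
  periodicity means that \<open>p ^ (r + 2)\<close> divides \<open>bernoulli n / n\<close>; this
  already implies the condition for the node itself.\<close>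

lemma irr_tree_iff:
  assumes "n = l + m * (p - 1)"
  shows "(r, n mod totient (p ^ Suc r)) \<in> irr_tree p l \<longleftrightarrow> pd (Suc r) (bernoulli n / of_nat n)"
proof (induction r)
  case 0
  have "n mod totient (p ^ Suc 0) = l" unfolding assms residue_totient by simp
  moreover have "pd (Suc 0) (bernoulli n / of_nat n)"
    unfolding assms pd_branch_iff[symmetric] using pd_branch by simp
  ultimately show ?case by (simp add: irr_tree.root)
next
  case (Suc r)
  define T where "T = totient (p ^ Suc r)"
  have T: "T > 0" using p_pos by (simp add: T_def)
  have TS: "totient (p ^ Suc (Suc r)) = p * T"
    unfolding T_def totient_prime_power_Suc[OF prime_p] by simp
  have Psi: "(p, n mod T) \<in> Psi_irr (r + 2) \<longleftrightarrow> pd (r + 2) (bernoulli n / of_nat n)"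
  proof -
    have "n mod T < T" using T by simp
    also have "T \<le> totient (p ^ (r + 2))" using TS p_pos by simp
    finally have "n mod T < totient (p ^ (r + 2))" .
    moreover have "n mod T = l + (m mod p ^ r) * (p - 1)" unfolding T_def assms by (rule residue_totient)
    then have "even (n mod T)" "n mod T \<ge> 2" using even_l odd_p l_ge_2 by auto
    ultimately show ?thesis
      using prime_p odd_p pd_residue_iff[OF assms, of r] by (auto simp: Psi_irr_def T_def)
  qed
  show ?case
  proof
    assume "(Suc r, n mod totient (p ^ Suc (Suc r))) \<in> irr_tree p l"
    then obtain l' j where l': "(r, l') \<in> irr_tree p l" "(p, l') \<in> Psi_irr (r + 2)"
        "n mod (p * T) = l' + j * T"
      unfolding TS by cases (auto simp: T_def)
    \<comment> \<open>Labels of height \<open>r\<close> lie below \<open>T\<close>, so reduction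
      modulo \<open>T\<close> recovers the parent.\<close>
    have "n mod T = n mod (p * T) mod T" by (simp add: mod_mult_self2_is_0 mod_mod_cancel)
    also have "\<dots> = l'" unfolding l'(3) using irr_tree_less[OF l'(1), folded T_def] by simp
    finally show "pd (Suc (Suc r)) (bernoulli n / of_nat n)" using l'(2) Psi by simp
  next
    assume b: "pd (Suc (Suc r)) (bernoulli n / of_nat n)"
    then have "pd (Suc r) (bernoulli n / of_nat n)" by (rule pd_mono) simp
    then have "(r, n mod T) \<in> irr_tree p l" using Suc.IH unfolding T_def by blast
    moreover have "(p, n mod T) \<in> Psi_irr (r + 2)" using Psi b by simp
    \<comment> \<open>The next digit of \<open>n\<close> selects the child on the path.\<close>
    moreover have "n div T mod p < p" using p_pos by simp
    ultimately have "(r + 1, n mod T + (n div T mod p) * totient (p ^ (r + 1))) \<in> irr_tree p l"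
      by (rule irr_tree.child)
    moreover have "n mod (p * T) = n mod T + (n div T mod p) * T"
      by (simp add: mod_mult2_eq mult.commute[of p])
    ultimately show "(Suc r, n mod totient (p ^ Suc (Suc r))) \<in> irr_tree p l"
      unfolding TS by (simp add: T_def)
  qed
qed

text \<open>By \<open>irr_tree_iff\<close> the heights on the path form an initial segment that ends
  one below the order of \<open>bernoulli n / n\<close>.\<close>

lemma irr_h0:
  assumes "n = l + m * (p - 1)" "bernoulli n \<noteq> 0"
  shows "int (1 + irr_h0 p l n) = rat_ord p (bernoulli n / of_nat n)"
proof -
  have nz: "bernoulli n / of_nat n \<noteq> 0"
    using assms(2) l_ge_2 unfolding assms(1) by (simp del: of_nat_add)
  have "pd 1 (bernoulli n / of_nat n)"
    unfolding assms(1) pd_branch_iff[symmetric] by (rule pd_branch)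
  then have ge: "rat_ord p (bernoulli n / of_nat n) \<ge> 1" using nz by (simp add: pow_dvd_rat_def)
  have "{r. \<exists>\<nu>\<ge>1. r + 1 = \<nu> \<and> (r, n mod totient (p ^ \<nu>)) \<in> irr_tree p l}
      = {r. (r, n mod totient (p ^ Suc r)) \<in> irr_tree p l}" by auto
  also have "\<dots> = {..nat (rat_ord p (bernoulli n / of_nat n) - 1)}"
    unfolding irr_tree_iff[OF assms(1)] using nz ge by (auto simp: pow_dvd_rat_def)
  finally have "irr_h0 p l n = nat (rat_ord p (bernoulli n / of_nat n) - 1)"
    unfolding irr_h0_def by (simp only:) (rule Max_eqI, simp_all)
  then show ?thesis using ge by simp
qed

text \<open>The root has children iff \<open>p ^ 2\<close> divides \<open>bernoulli l / l\<close>.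
  Periodicity at \<open>r = 0\<close> makes this equivalent to the same statement for
  \<open>n\<close>.\<close>

lemma irr_tree_trivial_iff:
  assumes "n = l + m * (p - 1)" "bernoulli n \<noteq> 0"
  shows "irr_tree_trivial p l \<longleftrightarrow> irr_h0 p l n = 0"
proof -
  have nz: "bernoulli n / of_nat n \<noteq> 0"
    using assms(2) l_ge_2 unfolding assms(1) by (simp del: of_nat_add)
  have h: "irr_h0 p l n = 0 \<longleftrightarrow> \<not> pd 2 (bernoulli n / of_nat n)"
    using irr_h0[OF assms] nz by (auto simp: pow_dvd_rat_def)
  have "irr_tree p l \<noteq> {(0, l)}" if "pd 2 (bernoulli n / of_nat n)"
  proof -
    have "(1, n mod totient (p ^ Suc 1)) \<in> irr_tree p l"
      using irr_tree_iff[OF assms(1), of 1] that by (simp add: numeral_2_eq_2)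
    then show ?thesis by auto
  qed
  moreover have "irr_tree p l = {(0, l)}" if "\<not> pd 2 (bernoulli n / of_nat n)"
  proof -
    have "n mod totient (p ^ Suc 0) = l" unfolding assms residue_totient by simp
    then have "\<not> pd 2 (bernoulli l / of_nat l)"
      using that pd_residue_iff[OF assms(1), of 0] by (simp add: numeral_2_eq_2)
    then have l: "(p, l) \<notin> Psi_irr 2" by (simp add: Psi_irr_def)
    have "r = 0 \<and> l' = l" if "(r, l') \<in> irr_tree p l" for r l'
      using that
    proof (induction rule: irr_tree.induct)
      case (child r l' j)
      then show ?case using l by (simp add: numeral_2_eq_2)
    qed simp
    then show ?thesis using irr_tree.root by fast
  qed
  ultimately show ?thesis unfolding irr_tree_trivial_def h by blast
qed

end

subsection \<open>The product formula\<close>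

lemma prod_prime_powers_superset:
  fixes a :: nat
  assumes "finite P" "\<And>q. q \<in> P \<Longrightarrow> prime q" "prime_factors a \<subseteq> P" "a > 0"
  shows "(\<Prod>q\<in>P. q ^ multiplicity q a) = a"
proof -
  have "(\<Prod>q\<in>P. q ^ multiplicity q a) = (\<Prod>q\<in>prime_factors a. q ^ multiplicity q a)"
    using assms by (intro prod.mono_neutral_right) (auto simp: prime_factors_multiplicity)
  then show ?thesis using prime_factorization_nat[OF assms(4)] by simp
qed

lemma positive_rat_eq_prod_powi_ord:
  assumes "x > 0" "finite P" "\<And>q. q \<in> P \<Longrightarrow> prime q"
    "\<And>q. prime q \<Longrightarrow> q \<notin> P \<Longrightarrow> rat_ord q x = 0"
  shows "x = (\<Prod>q\<in>P. of_nat q powi rat_ord q x)"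
proof -
  obtain c d where cd: "quotient_of x = (c, d)" by fastforce
  have d: "d > 0" and x: "x = of_int c / of_int d"
    using quotient_of_denom_pos[OF cd] quotient_of_div[OF cd] by auto
  have c: "c > 0" using assms(1) d unfolding x by (simp add: zero_less_divide_iff)
  define a b where "a = nat c" and "b = nat d"
  have ab: "a > 0" "b > 0" "c = int a" "d = int b" using c d by (auto simp: a_def b_def)
  \<comment> \<open>\<open>P\<close> is enlarged by all primes of numerator and denominator; the
    added factors are 1 by hypothesis.\<close>
  define Q where "Q = P \<union> prime_factors a \<union> prime_factors b"
  have Q: "finite Q" "\<And>q. q \<in> Q \<Longrightarrow> prime q" "P \<subseteq> Q" "prime_factors a \<subseteq> Q" "prime_factors b \<subseteq> Q"
    using assms(2,3) by (auto simp: Q_def)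
  have ord: "of_nat q powi rat_ord q x = of_nat q ^ multiplicity q a / (of_nat q ^ multiplicity q b :: rat)"
    if "q \<in> Q" for q
  proof -
    interpret rat_adic q using Q(2)[OF that] by unfold_locales
    have "rat_ord q x = int (multiplicity q a) - int (multiplicity q b)"
      using ab prime_p rat_ord_fract[of "int a" "int b"] unfolding x ab
      by (simp add: multiplicity_of_nat_int)
    then show ?thesis using p_pos by (simp add: power_int_diff)
  qed
  have "x = of_nat a / of_nat b" unfolding x ab by simp
  also have "of_nat a = (\<Prod>q\<in>Q. of_nat q ^ multiplicity q a :: rat)"
    using prod_prime_powers_superset[OF Q(1,2,4) ab(1)] by (simp flip: of_nat_power of_nat_prod)
  also have "of_nat b = (\<Prod>q\<in>Q. of_nat q ^ multiplicity q b :: rat)"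
    using prod_prime_powers_superset[OF Q(1,2,5) ab(2)] by (simp flip: of_nat_power of_nat_prod)
  finally have "x = (\<Prod>q\<in>Q. of_nat q powi rat_ord q x)"
    using ord by (simp add: prod_dividef)
  also have "\<dots> = (\<Prod>q\<in>P. of_nat q powi rat_ord q x)"
    using assms(4) Q by (intro prod.mono_neutral_right) auto
  finally show ?thesis .
qed

section \<open>Bernoulli quotients and residues modulo \<open>p - 1\<close>\<close>

context rat_adic
begin

lemma rat_ord_uminus: "rat_ord p (- x) = rat_ord p x"
proof (cases "x = 0")
  case False
  moreover have "rat_ord p (- 1) = 0"
    using rat_ord_fract[of "- 1" 1] by (simp add: multiplicity_unit_right)
  ultimately show ?thesis using rat_ord_mult[of "- 1" x] by simp
qed simp

text \<open>Kummer's congruence moves divisibility by \<open>p\<close> from \<open>n\<close> to its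
  residue modulo \<open>p - 1\<close>, where it is the definition of an irregular pair.\<close>

lemma bernoulli_quotient_residue:
  assumes "even n" "n > 0" "\<not> (p - 1) dvd n"
  shows "pd 0 (bernoulli n / of_nat n)"
    and "pd 1 (bernoulli n / of_nat n) \<longleftrightarrow> (p, n mod (p - 1)) \<in> Psi_irr 1"
proof -
  define l where "l = n mod (p - 1)"
  define m where "m = n div (p - 1)"
  have n: "n = l + m * (p - 1)" by (simp only: l_def m_def mod_div_mult_eq)
  \<comment> \<open>For \<open>p = 2\<close> the number \<open>p - 1\<close> divides everything,
    contrary to the hypothesis.\<close>
  have odd: "odd p" using assms(3) prime_p prime_odd_nat p_gt_1 by (cases "p = 2") auto
  have l: "\<not> (p - 1) dvd l" using assms(3) by (simp add: l_def dvd_mod_iff)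
  have ev: "even l" using assms(1) odd unfolding n by simp
  have "l \<noteq> 0" using l by (metis dvd_0_right)
  then have l2: "l \<ge> 2" using ev by (cases "l = 1") auto
  have n2: "n \<ge> 2" using n l2 by simp
  have b: "pd k (bernoulli n / of_nat n) \<longleftrightarrow> pd k (branch l m)" for k
    unfolding branch_def n[symmetric] pd_euler_quotient_iff[OF n2] ..
  show "pd 0 (bernoulli n / of_nat n)"
    unfolding b using branch_integral[OF l] l2 by simp
  have "pd 1 (branch l m - branch l 0)" using branch_kummer[OF l] l2 by simp
  then have "pd 1 (bernoulli n / of_nat n) \<longleftrightarrow> pd 1 (branch l 0)" unfolding b by (rule pd_cong)
  also have "\<dots> \<longleftrightarrow> pd 1 (bernoulli l / of_nat l)"
    unfolding branch_def using pd_euler_quotient_iff[OF l2] by simp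
  also have "\<dots> \<longleftrightarrow> (p, l) \<in> Psi_irr 1"
  proof -
    have "l < totient (p ^ 1)" using p_gt_1 prime_p by (simp add: l_def totient_prime)
    then show ?thesis using prime_p odd l2 ev by (simp add: Psi_irr_def)
  qed
  finally show "pd 1 (bernoulli n / of_nat n) \<longleftrightarrow> (p, n mod (p - 1)) \<in> Psi_irr 1"
    unfolding l_def .
qed

end

context irregular_pair
begin

text \<open>The last equation shows that the integer division in the argument of \<chi> is
  exact.\<close>

lemma residue_eq:
  assumes "[n = l] (mod (p - 1))"
  shows "n mod (p - 1) = l" "n = l + n div (p - 1) * (p - 1)"
    "(int n - int l) div (int p - 1) = int (n div (p - 1))"
proof -
  show 1: "n mod (p - 1) = l" using assms l_less by (simp add: cong_def)
  then show 2: "n = l + n div (p - 1) * (p - 1)" by (metis mod_div_mult_eq)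
  have "int n = int l + int (n div (p - 1)) * (int p - 1)"
    by (subst 2) (use p_gt_1 in \<open>simp add: of_nat_diff\<close>)
  then have "int n - int l = int (n div (p - 1)) * (int p - 1)" by simp
  then show "(int n - int l) div (int p - 1) = int (n div (p - 1))" using p_gt_1 by simp
qed

end

text \<open>Finiteness is asserted because a product over an infinite set is 1 by convention. For
  the same reason the first product is restricted to primes whose factor is not 1.\<close>

theorem theorem4p3:
  fixes n :: nat
  assumes "even n" and "n > 0"
  shows
    "finite {p. prime p \<and> \<not> (p - 1) dvd n \<and> rat_abs p (of_nat n) \<noteq> 1}
     \<and> finite {(p, l). (p, l) \<in> Psi_irr 1 \<and> [n = l] (mod (p - 1))}
     \<and> finite {p. prime p \<and> (p - 1) dvd n}
     \<and> bernoulli n =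
         (- 1) ^ (n div 2 - 1)
         * (\<Prod>p\<in>{p. prime p \<and> \<not> (p - 1) dvd n \<and> rat_abs p (of_nat n) \<noteq> 1}.
              inverse (rat_abs p (of_nat n)))
         * (\<Prod>(p, l)\<in>{(p, l). (p, l) \<in> Psi_irr 1 \<and> irr_Delta 1 p l \<noteq> 0 \<and> [n = l] (mod (p - 1))}.
              inverse (Zp_abs p
                (Zp_of_int p (int p) \<otimes>\<^bsub>Zp p\<^esub>
                   (irr_chi p l \<ominus>\<^bsub>Zp p\<^esub> Zp_of_int p ((int n - int l) div (int p - 1))))))
         * (\<Prod>(p, l)\<in>{(p, l). (p, l) \<in> Psi_irr 1 \<and> irr_Delta 1 p l = 0 \<and> [n = l] (mod (p - 1))}.
              of_nat p ^ (1 + irr_h0 p l n))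
         * (\<Prod>p\<in>{p. prime p \<and> (p - 1) dvd n}. inverse (of_nat p))
     \<and> (\<forall>p l. (p, l) \<in> Psi_irr 1 \<and> irr_Delta 1 p l = 0 \<and> [n = l] (mod (p - 1)) \<longrightarrow>
          (irr_h0 p l n = 0 \<longleftrightarrow> irr_tree_trivial p l)
          \<and> (\<not> irr_tree_trivial p l \<longrightarrow> irr_h0 p l n \<ge> 1))"
proof -
  define A where "A = {p. prime p \<and> \<not> (p - 1) dvd n \<and> rat_abs p (of_nat n) \<noteq> 1}"
  define I where "I = {(p, l). (p, l) \<in> Psi_irr 1 \<and> [n = l] (mod (p - 1))}"
  define I1 where "I1 = {(p, l). (p, l) \<in> Psi_irr 1 \<and> irr_Delta 1 p l \<noteq> 0 \<and> [n = l] (mod (p - 1))}"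
  define I0 where "I0 = {(p, l). (p, l) \<in> Psi_irr 1 \<and> irr_Delta 1 p l = 0 \<and> [n = l] (mod (p - 1))}"
  define C where "C = {p. prime p \<and> (p - 1) dvd n}"
  define \<beta> where "\<beta> = bernoulli n / of_nat n"
  \<comment> \<open>\<open>x\<close> is the absolute value of \<open>bernoulli n\<close>, hence
    determined by its orders.\<close>
  define x where "x = (- 1) ^ (n div 2 - 1) * bernoulli n"
  have x: "x > 0" unfolding x_def by (rule bernoulli_sign[OF assms])
  have Bx: "bernoulli n = (- 1) ^ (n div 2 - 1) * x"
    unfolding x_def by (simp add: mult.assoc[symmetric] flip: power_mult_distrib)
  have B0: "bernoulli n \<noteq> 0" using x by (auto simp: x_def)
  then have \<beta>0: "\<beta> \<noteq> 0" using assms(2) by (simp add: \<beta>_def)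
  have adic: "rat_adic p" if "prime p" for p using that by unfold_locales
  have pairI: "irregular_pair p l" if "(p, l) \<in> Psi_irr 1" for p l
    using that by unfold_locales (auto simp: Psi_irr_def)

  have ord_x: "rat_ord p x = rat_ord p (bernoulli n)" if "prime p" for p
    using rat_adic.rat_ord_uminus[OF adic[OF that]] unfolding x_def by (simp add: minus_one_power_iff)
  have ord_B: "rat_ord p (bernoulli n) = rat_ord p (of_nat n) + rat_ord p \<beta>" if "prime p" for p
    using rat_adic.rat_ord_mult[OF adic[OF that], of "of_nat n" \<beta>] \<beta>0 assms(2) by (simp add: \<beta>_def)
  have pairD: "prime p \<and> \<not> (p - 1) dvd n \<and> n mod (p - 1) = l \<and> pow_dvd_rat p 1 \<beta>"
    if "(p, l) \<in> I" for p l
  proof -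
    have *: "(p, l) \<in> Psi_irr 1" "[n = l] (mod (p - 1))" using that by (auto simp: I_def)
    interpret irregular_pair p l using *(1) by (rule pairI)
    have l: "n mod (p - 1) = l" using *(2) by (rule residue_eq)
    then have "\<not> (p - 1) dvd n" using l_ge_2 by auto
    then show ?thesis
      using l prime_p bernoulli_quotient_residue(2)[OF assms] * by (simp add: \<beta>_def)
  qed

  have finA: "finite A"
  proof (rule finite_subset)
    show "A \<subseteq> {..n}"
    proof
      fix p assume p: "p \<in> A"
      interpret rat_adic p using p by (intro adic) (simp add: A_def)
      have "rat_ord p (of_nat n) \<noteq> 0" using p assms(2) by (auto simp: A_def rat_abs_def)
      then have "p dvd n" using rat_ord_of_nat[OF assms(2)] not_dvd_imp_multiplicity_0 by fastforce
      then show "p \<in> {..n}" using assms(2) dvd_imp_le by simp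
    qed
  qed simp
  have finC: "finite C"
  proof (rule finite_subset)
    show "C \<subseteq> {..n + 1}"
    proof
      fix p assume "p \<in> C"
      then have "p - 1 \<le> n" using assms(2) dvd_imp_le by (simp add: C_def)
      then show "p \<in> {..n + 1}" by simp
    qed
  qed simp
  \<comment> \<open>Every \<open>p\<close> from \<open>I\<close> divides the nonzero numerator of
    \<open>\<beta>\<close> and determines \<open>l\<close>, which bounds \<open>I\<close>.\<close>
  obtain c d where cd: "quotient_of \<beta> = (c, d)" by fastforce
  have c0: "c \<noteq> 0" using quotient_of_div[OF cd] \<beta>0 by auto
  have finI: "finite I"
  proof (rule finite_subset)
    show "I \<subseteq> (\<lambda>p. (p, n mod (p - 1))) ` {..nat \<bar>c\<bar>}"
    proof (clarify)
      fix p l assume pl: "(p, l) \<in> I"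
      have "rat_ord p \<beta> \<ge> 1" using pairD[OF pl] \<beta>0 by (simp add: pow_dvd_rat_def)
      then have "multiplicity (int p) c \<noteq> 0" by (simp add: rat_ord_def cd)
      then have "int p dvd c" by (metis not_dvd_imp_multiplicity_0)
      from dvd_imp_le_int[OF c0 this] have "int p \<le> \<bar>c\<bar>" by simp
      then show "(p, l) \<in> (\<lambda>p. (p, n mod (p - 1))) ` {..nat \<bar>c\<bar>}" using pairD[OF pl] by auto
    qed
  qed simp
  have I: "I = I1 \<union> I0" "I1 \<inter> I0 = {}" by (auto simp: I_def I1_def I0_def)
  \<comment> \<open>\<open>l\<close> is the residue of \<open>n\<close> modulo \<open>p - 1\<close>,
    so that products over pairs are products over primes.\<close>
  have injI: "inj_on fst I" by (rule inj_onI) (metis pairD prod.collapse)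

  have m1: "rat_ord p x = - 1" if "p \<in> C" for p
  proof -
    have p: "prime p" "(p - 1) dvd n" using that by (auto simp: C_def)
    then show ?thesis using rat_adic.von_staudt_clausen_ord[OF adic assms] by (simp add: ord_x)
  qed
  have ord_\<beta>: "rat_ord p \<beta> = 0" if "prime p" "\<not> (p - 1) dvd n" "p \<notin> fst ` I" for p
  proof -
    interpret rat_adic p using that(1) by (rule adic)
    have "(p, n mod (p - 1)) \<notin> Psi_irr 1"
    proof
      assume "(p, n mod (p - 1)) \<in> Psi_irr 1"
      then have "(p, n mod (p - 1)) \<in> I" by (simp add: I_def cong_def)
      then show False using that(3) by force
    qed
    then have "pd 0 \<beta>" "\<not> pd 1 \<beta>"
      using bernoulli_quotient_residue[OF assms that(2)] by (simp_all add: \<beta>_def)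
    then show ?thesis using \<beta>0 by (simp add: pow_dvd_rat_def)
  qed
  have inv_abs: "inverse (rat_abs p (of_nat n)) = of_nat p powi rat_ord p (of_nat n)" for p
    using assms(2) by (simp add: rat_abs_def power_int_minus)

  \<comment> \<open>The primes of \<open>A\<close> and of \<open>I\<close> may overlap. The product
    over their union is therefore split into the contributions of \<open>n\<close> and
    \<open>\<beta>\<close>, and each is then restricted to its own primes.\<close>
  define R where "R = A \<union> fst ` I"
  have R: "prime p \<and> \<not> (p - 1) dvd n" if "p \<in> R" for p
    using that pairD by (auto simp: R_def A_def)
  have finR: "finite R" using finA finI by (simp add: R_def)
  have "x = (\<Prod>p\<in>C \<union> R. of_nat p powi rat_ord p x)"
  proof (rule positive_rat_eq_prod_powi_ord[OF x])
    show "finite (C \<union> R)" using finC finR by simp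
    show "prime p" if "p \<in> C \<union> R" for p using that R by (auto simp: C_def)
    show "rat_ord p x = 0" if p: "prime p" "p \<notin> C \<union> R" for p
    proof -
      have nd: "\<not> (p - 1) dvd n" using p by (auto simp: C_def)
      have ord_n: "rat_ord p (of_nat n) = int (multiplicity p n)"
        using rat_adic.rat_ord_of_nat[OF adic[OF p(1)] assms(2)] .
      have "rat_abs p (of_nat n) = 1" using p nd by (auto simp: R_def A_def)
      then have "(of_nat p :: rat) ^ multiplicity p n = 1"
        using assms(2) by (simp add: rat_abs_def ord_n power_int_minus)
      moreover have "(1 :: rat) < of_nat p" using prime_gt_1_nat[OF p(1)] by simp
      ultimately have "multiplicity p n = 0" by (metis less_irrefl not_gr_zero one_less_power)
      then have "rat_ord p (of_nat n) = 0" by (simp add: ord_n)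
      moreover have "rat_ord p \<beta> = 0" using ord_\<beta> p nd by (simp add: R_def)
      ultimately show ?thesis using ord_x ord_B p by simp
    qed
  qed
  also have "\<dots> = (\<Prod>p\<in>C. of_nat p powi rat_ord p x) * (\<Prod>p\<in>R. of_nat p powi rat_ord p x)"
    using finC finR R by (intro prod.union_disjoint) (auto simp: C_def)
  also have "(\<Prod>p\<in>C. of_nat p powi rat_ord p x) = (\<Prod>p\<in>C. inverse (of_nat p))"
    using m1 by (intro prod.cong) (simp_all add: power_int_minus)
  also have "(\<Prod>p\<in>R. of_nat p powi rat_ord p x)
      = (\<Prod>p\<in>R. inverse (rat_abs p (of_nat n)) * of_nat p powi rat_ord p \<beta>)"
  proof (rule prod.cong[OF refl])
    fix p assume "p \<in> R"
    then have "prime p" using R by blast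
    then show "of_nat p powi rat_ord p x = inverse (rat_abs p (of_nat n)) * of_nat p powi rat_ord p \<beta>"
      using prime_gt_0_nat[of p] by (simp add: ord_x ord_B inv_abs power_int_add)
  qed
  also have "\<dots> = (\<Prod>p\<in>R. inverse (rat_abs p (of_nat n))) * (\<Prod>p\<in>R. of_nat p powi rat_ord p \<beta>)"
    by (rule prod.distrib)
  also have "(\<Prod>p\<in>R. inverse (rat_abs p (of_nat n))) = (\<Prod>p\<in>A. inverse (rat_abs p (of_nat n)))"
  proof (rule prod.mono_neutral_right[OF finR])
    show "A \<subseteq> R" by (simp add: R_def)
    show "\<forall>p\<in>R - A. inverse (rat_abs p (of_nat n)) = 1" using R by (auto simp: A_def)
  qed
  also have "(\<Prod>p\<in>R. of_nat p powi rat_ord p \<beta>) = (\<Prod>p\<in>fst ` I. of_nat p powi rat_ord p \<beta>)"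
  proof (rule prod.mono_neutral_right[OF finR])
    show "fst ` I \<subseteq> R" by (simp add: R_def)
    show "\<forall>p\<in>R - fst ` I. of_nat p powi rat_ord p \<beta> = 1" using R ord_\<beta> by auto
  qed
  also have "\<dots> = (\<Prod>(p, l)\<in>I. of_nat p powi rat_ord p \<beta>)"
    using injI by (simp add: prod.reindex case_prod_beta)
  also have "\<dots> = (\<Prod>(p, l)\<in>I1. of_nat p powi rat_ord p \<beta>) * (\<Prod>(p, l)\<in>I0. of_nat p powi rat_ord p \<beta>)"
    using finI I by (simp add: prod.union_disjoint)
  also have "(\<Prod>(p, l)\<in>I1. of_nat p powi rat_ord p \<beta>)
      = (\<Prod>(p, l)\<in>I1. inverse (Zp_abs p (Zp_of_int p (int p) \<otimes>\<^bsub>Zp p\<^esub>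
                   (irr_chi p l \<ominus>\<^bsub>Zp p\<^esub> Zp_of_int p ((int n - int l) div (int p - 1))))))"
  proof (rule prod.cong[OF refl], clarify)
    fix p l assume "(p, l) \<in> I1"
    then have pl: "(p, l) \<in> Psi_irr 1" "irr_Delta 1 p l \<noteq> 0" "[n = l] (mod (p - 1))"
      by (auto simp: I1_def)
    interpret irregular_pair p l using pl(1) by (rule pairI)
    interpret irregular_pair_simple p l
      using pl(2) irr_Delta_eq_0_iff by unfold_locales simp
    show "of_nat p powi rat_ord p \<beta> = inverse (Zp_abs p (Zp_of_int p (int p) \<otimes>\<^bsub>Zp p\<^esub>
                   (irr_chi p l \<ominus>\<^bsub>Zp p\<^esub> Zp_of_int p ((int n - int l) div (int p - 1)))))"
      unfolding residue_eq(3)[OF pl(3)] \<beta>_def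
      by (rule Zp_abs_chi[OF residue_eq(2)[OF pl(3)] B0, symmetric])
  qed
  also have "(\<Prod>(p, l)\<in>I0. of_nat p powi rat_ord p \<beta>) = (\<Prod>(p, l)\<in>I0. of_nat p ^ (1 + irr_h0 p l n))"
  proof (rule prod.cong[OF refl], clarify)
    fix p l assume "(p, l) \<in> I0"
    then have pl: "(p, l) \<in> Psi_irr 1" "irr_Delta 1 p l = 0" "[n = l] (mod (p - 1))"
      by (auto simp: I0_def)
    interpret irregular_pair p l using pl(1) by (rule pairI)
    interpret irregular_pair_singular p l
      using pl(2) irr_Delta_eq_0_iff by unfold_locales simp
    have "rat_ord p \<beta> = int (1 + irr_h0 p l n)"
      unfolding \<beta>_def by (rule irr_h0[OF residue_eq(2)[OF pl(3)] B0, symmetric])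
    then show "of_nat p powi rat_ord p \<beta> = of_nat p ^ (1 + irr_h0 p l n)"
      by (simp only: power_int_of_nat)
  qed
  finally have prod: "bernoulli n = (- 1) ^ (n div 2 - 1)
      * (\<Prod>p\<in>A. inverse (rat_abs p (of_nat n)))
      * (\<Prod>(p, l)\<in>I1. inverse (Zp_abs p (Zp_of_int p (int p) \<otimes>\<^bsub>Zp p\<^esub>
            (irr_chi p l \<ominus>\<^bsub>Zp p\<^esub> Zp_of_int p ((int n - int l) div (int p - 1))))))
      * (\<Prod>(p, l)\<in>I0. of_nat p ^ (1 + irr_h0 p l n))
      * (\<Prod>p\<in>C. inverse (of_nat p))"
    using Bx by (simp only: mult_ac)
  have tree: "irr_h0 p l n = 0 \<longleftrightarrow> irr_tree_trivial p l"
    if pl: "(p, l) \<in> Psi_irr 1" "irr_Delta 1 p l = 0" "[n = l] (mod (p - 1))" for p l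
  proof -
    interpret irregular_pair p l using pl(1) by (rule pairI)
    interpret irregular_pair_singular p l
      using pl(2) irr_Delta_eq_0_iff by unfold_locales simp
    show ?thesis using irr_tree_trivial_iff[OF residue_eq(2)[OF pl(3)] B0] ..
  qed
  show ?thesis
    unfolding A_def[symmetric] I_def[symmetric] I1_def[symmetric] I0_def[symmetric] C_def[symmetric]
    using finA finI finC prod tree by (auto simp: Suc_le_eq)
qed

end
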